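(* Consider $\min_{y\in\mathbb R^{n_y}}\sum_{i\in\mathcal I}f_i(y)$ with nonempty solution set $\mathcal Y^\star$, where each $f_i$ depends only on $(y_p)_{p\in\mathcal N(i)}$, and the stacked iteration $$\boldsymbol y^{k+1}=A\boldsymbol y^k-\gamma B\nabla\boldsymbol f(\boldsymbol y^k)-\boldsymbol z^k,\qquad \boldsymbol z^{k+1}=\boldsymbol z^k+C\boldsymbol y^{k+1},$$ with $A=\mathrm{diag}((A_p\otimes I_{n_{y_p}})_p)$, $B=\mathrm{diag}((B_p\otimes I_{n_{y_p}})_p)$, $C=\mathrm{diag}((C_p\otimes I_{n_{y_p}})_p)$ for matrices $A_p,B_p,C_p\in\mathbb R^{N_p\times N_p}$. Let $D=\mathrm{diag}((D_p\otimes I_{n_{y_p}})_p)$ for some $D_p\in\mathbb R^{N_p\times N_p}$. Assume each $f_i$ is convex and $L$-smooth, and: (i) $A=BD$, $B\succeq0$, $D\succ0$; (ii) $D\boldsymbol y=\boldsymbol y$ and $B\boldsymbol y=\boldsymbol y$ for all $\boldsymbol y\in\mathcal C$; (iii) $C\succeq0$ and $\mathrm{null}(C)=\mathcal C$; (iv) $BC=CB$; (v) $I-\tfrac12C-\sqrt B\,D\sqrt B\succeq0$. Let $y^\star\in\mathcal Y^\star$, $\boldsymbol y^\star$ the stacked vector with all estimates of $y_p$ equal to $y^\star_p$, and $\mathfrak M(\boldsymbol y):=\max\{\|\Pi_\perp\boldsymbol y\|\,\|\nabla\boldsymbol f(\boldsymbol y^\star)\|,\ |\boldsymbol f(\boldsymbol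 y)-\boldsymbol f(\boldsymbol y^\star)|\}$. Then for any $\boldsymbol y^0$, $\boldsymbol z^0=0$ and $\gamma\in(0,\lambda_{\min}(D)/L)$, the sequence satisfies $\mathfrak M(\boldsymbol y^k_{\mathrm{avg}})\le\mathcal O(1/k)$ for all $k$, where $\boldsymbol y^k_{\mathrm{avg}}=\frac1k\sum_{t=1}^k\boldsymbol y^t$.
   Context: Agents $\mathcal I=\{1,\dots,I\}$; $y=\mathrm{col}((y_p)_{p\in\mathcal P})$, $\mathcal P=\{1,\dots,P\}$, $y_p\in\mathbb R^{n_{y_p}}$; $\mathcal N(i)\subseteq\mathcal P$ are the blocks on which $f_i$ depends. For each $p$, a set $\mathcal V_p\subseteq\mathcal I$ with $\{i:p\in\mathcal N(i)\}\subseteq\mathcal V_p$, $N_p=|\mathcal V_p|$; agent $i\in\mathcal V_p$ keeps $\boldsymbol y_{i,p},\boldsymbol z_{i,p}\in\mathbb R^{n_{y_p}}$, indexed by its position $i_p$ in $\mathcal V_p$. Stacked: $\boldsymbol y=\mathrm{col}((\boldsymbol y_p)_p)$, $\boldsymbol y_p=\mathrm{col}((\boldsymbol y_{i,p})_{i\in\mathcal V_p})$, similarly $\boldsymbol z$. $\tilde{\boldsymbol y}_i$ collects agent $i$'s estimates and $\boldsymbol f(\boldsymbol y)=\sum_i f_i(\tilde{\boldsymbol y}_i)$ ($f_i$ evaluated with $y_p$ replaced by $\boldsymbol y_{i,p}$); thus the $(i,p)$ block of $\nabla\boldsymbol f(\boldsymbol y)$ is $\nabla_{y_p}f_i(\tilde{\boldsymbol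 y}_i)$. Consensus space $\mathcal C=\{\boldsymbol y:\boldsymbol y_p=\mathbf 1_{N_p}\otimes v_p,\ v_p\in\mathbb R^{n_{y_p}}\ \forall p\}$; $\Pi_\parallel=\mathrm{diag}((\tfrac1{N_p}\mathbf 1\mathbf 1^\top\otimes I_{n_{y_p}})_p)$ and $\Pi_\perp=I-\Pi_\parallel$. *)

theory Defs
  imports "HOL-Analysis.Analysis"
begin

text \<open>A matrix over index set S is a function M :: 'a => 'a => real; only entries in S x S
  matter. Vectors are functions 'a => real; only entries in S matter.\<close>

definition mat_vec :: "'a set \<Rightarrow> ('a \<Rightarrow> 'a \<Rightarrow> real) \<Rightarrow> ('a \<Rightarrow> real) \<Rightarrow> 'a \<Rightarrow> real" where
  "mat_vec S M v x = (\<Sum>y\<in>S. M x y * v y)"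

definition mat_mult :: "'a set \<Rightarrow> ('a \<Rightarrow> 'a \<Rightarrow> real) \<Rightarrow> ('a \<Rightarrow> 'a \<Rightarrow> real) \<Rightarrow> 'a \<Rightarrow> 'a \<Rightarrow> real" where
  "mat_mult S M N x z = (\<Sum>y\<in>S. M x y * N y z)"

definition mat_eq :: "'a set \<Rightarrow> ('a \<Rightarrow> 'a \<Rightarrow> real) \<Rightarrow> ('a \<Rightarrow> 'a \<Rightarrow> real) \<Rightarrow> bool" where
  "mat_eq S M N \<longleftrightarrow> (\<forall>x\<in>S. \<forall>y\<in>S. M x y = N x y)"

definition mat_sym :: "'a set \<Rightarrow> ('a \<Rightarrow> 'a \<Rightarrow> real) \<Rightarrow> bool" where
  "mat_sym S M \<longleftrightarrow> (\<forall>x\<in>S. \<forall>y\<in>S. M x y = M y x)"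

definition mat_psd :: "'a set \<Rightarrow> ('a \<Rightarrow> 'a \<Rightarrow> real) \<Rightarrow> bool" where
  "mat_psd S M \<longleftrightarrow> mat_sym S M \<and> (\<forall>v. 0 \<le> (\<Sum>x\<in>S. v x * mat_vec S M v x))"

definition mat_pd :: "'a set \<Rightarrow> ('a \<Rightarrow> 'a \<Rightarrow> real) \<Rightarrow> bool" where
  "mat_pd S M \<longleftrightarrow> mat_sym S M \<and> (\<forall>v. (\<exists>x\<in>S. v x \<noteq> 0) \<longrightarrow> 0 < (\<Sum>x\<in>S. v x * mat_vec S M v x))"

definition mat_id :: "'a \<Rightarrow> 'a \<Rightarrow> real" where
  "mat_id x y = (if x = y then 1 else 0)"

definition mat_sqrt :: "'a set \<Rightarrow> ('a \<Rightarrow> 'a \<Rightarrow> real) \<Rightarrow> 'a \<Rightarrow> 'a \<Rightarrow> real" where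
  "mat_sqrt S M = (THE R. mat_psd S R \<and> (\<forall>x y. (x \<notin> S \<or> y \<notin> S) \<longrightarrow> R x y = 0)
                          \<and> mat_eq S (mat_mult S R R) M)"

definition mat_eigenvalues :: "'a set \<Rightarrow> ('a \<Rightarrow> 'a \<Rightarrow> real) \<Rightarrow> real set" where
  "mat_eigenvalues S M = {e. \<exists>v. (\<exists>x\<in>S. v x \<noteq> 0) \<and> (\<forall>x\<in>S. mat_vec S M v x = e * v x)}"

definition lambda_min :: "'a set \<Rightarrow> ('a \<Rightarrow> 'a \<Rightarrow> real) \<Rightarrow> real" where
  "lambda_min S M = Min (mat_eigenvalues S M)"

definition vnorm :: "'a set \<Rightarrow> ('a \<Rightarrow> real) \<Rightarrow> real" where
  "vnorm S v = sqrt (\<Sum>x\<in>S. (v x)\<^sup>2)"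

definition grad :: "(real ^ 'k \<Rightarrow> real) \<Rightarrow> real ^ 'k \<Rightarrow> real ^ 'k" where
  "grad f x = (THE g. (f has_derivative (\<lambda>h. g \<bullet> h)) (at x))"

definition L_smooth :: "real \<Rightarrow> (real ^ 'k \<Rightarrow> real) \<Rightarrow> bool" where
  "L_smooth L f \<longleftrightarrow> (\<forall>x. f differentiable (at x))
      \<and> (\<forall>x y. norm (grad f x - grad f y) \<le> L * norm (x - y))"

text \<open>Coordinates of y are indexed by 'k; blk k is the block p containing coordinate k
  (so y_p = (y$k) for blk k = p, n_{y_p} = card {k. blk k = p}). Agents are indexed by 'i.
  A stacked vector is a function on pairs (i,k), meaningful on
  stack_idx blk V = {(i,k). i \<in> V (blk k)}: the entry (i,k) is coordinate k of agent i's
  estimate of block blk k.\<close>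

definition stack_idx :: "('k \<Rightarrow> 'p) \<Rightarrow> ('p \<Rightarrow> 'i set) \<Rightarrow> ('i \<times> 'k) set" where
  "stack_idx blk V = {(i,k). i \<in> V (blk k)}"

text \<open>diag((M_p \<otimes> I_{n_{y_p}})_p), with M_p indexed by the agents in V_p.\<close>
definition big_mat :: "('k \<Rightarrow> 'p) \<Rightarrow> ('p \<Rightarrow> 'i \<Rightarrow> 'i \<Rightarrow> real) \<Rightarrow> ('i \<times> 'k) \<Rightarrow> ('i \<times> 'k) \<Rightarrow> real" where
  "big_mat blk M = (\<lambda>(i,k) (i',k'). if k = k' then M (blk k) i i' else 0)"

definition consensus :: "('k \<Rightarrow> 'p) \<Rightarrow> ('p \<Rightarrow> 'i set) \<Rightarrow> (('i \<times> 'k) \<Rightarrow> real) set" where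
  "consensus blk V = {Y. \<exists>v :: 'k \<Rightarrow> real. \<forall>(i,k) \<in> stack_idx blk V. Y (i,k) = v k}"

definition Pi_perp :: "('k \<Rightarrow> 'p) \<Rightarrow> ('p \<Rightarrow> 'i set) \<Rightarrow> (('i \<times> 'k) \<Rightarrow> real) \<Rightarrow> ('i \<times> 'k) \<Rightarrow> real" where
  "Pi_perp blk V Y = (\<lambda>(i,k). Y (i,k) - (\<Sum>i'\<in>V (blk k). Y (i',k)) / real (card (V (blk k))))"

text \<open>Agent i's local copy \<tilde>y_i, viewed as a point of R^{n_y}
  (coordinates of blocks not held by agent i set to 0; f_i does not depend on them).\<close>
definition local_copy :: "('k \<Rightarrow> 'p) \<Rightarrow> ('p \<Rightarrow> 'i set) \<Rightarrow> (('i \<times> 'k) \<Rightarrow> real) \<Rightarrow> 'i \<Rightarrow> real ^ 'k" where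
  "local_copy blk V Y i = (\<chi> k. if i \<in> V (blk k) then Y (i,k) else 0)"

definition stack_f :: "('k::finite \<Rightarrow> 'p) \<Rightarrow> ('p \<Rightarrow> 'i::finite set) \<Rightarrow> ('i \<Rightarrow> real ^ 'k \<Rightarrow> real)
    \<Rightarrow> (('i \<times> 'k) \<Rightarrow> real) \<Rightarrow> real" where
  "stack_f blk V f Y = (\<Sum>i\<in>UNIV. f i (local_copy blk V Y i))"

definition stack_grad :: "('k::finite \<Rightarrow> 'p) \<Rightarrow> ('p \<Rightarrow> 'i set) \<Rightarrow> ('i \<Rightarrow> real ^ 'k \<Rightarrow> real)
    \<Rightarrow> (('i \<times> 'k) \<Rightarrow> real) \<Rightarrow> ('i \<times> 'k) \<Rightarrow> real" where
  "stack_grad blk V f Y = (\<lambda>(i,k). grad (f i) (local_copy blk V Y i) $ k)"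

definition merit :: "('k::finite \<Rightarrow> 'p) \<Rightarrow> ('p \<Rightarrow> 'i::finite set) \<Rightarrow> ('i \<Rightarrow> real ^ 'k \<Rightarrow> real)
    \<Rightarrow> (('i \<times> 'k) \<Rightarrow> real) \<Rightarrow> (('i \<times> 'k) \<Rightarrow> real) \<Rightarrow> real" where
  "merit blk V f Ystar Y = max (vnorm (stack_idx blk V) (Pi_perp blk V Y) * vnorm (stack_idx blk V) (stack_grad blk V f Ystar))
                               \<bar>stack_f blk V f Y - stack_f blk V f Ystar\<bar>"

end

theory Submission
  imports Defs
begin

text \<open>
  Write \<open>R\<close> for the square root of \<open>B\<close>. Since \<open>z\<close> starts at \<open>0\<close> and \<open>B\<close> commutes with \<open>C\<close>, all iterates
  stay in the range of \<open>R\<close>: there are \<open>Q\<^sub>t\<close> with \<open>Q\<^sub>0 = 0\<close>, \<open>y\<^sub>t\<^sub>+\<^sub>1 = R (Q\<^sub>t\<^sub>+\<^sub>1 - Q\<^sub>t)\<close> and \<open>z\<^sub>t = R C Q\<^sub>t\<close>.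
  Pairing the update of \<open>Q\<close> with \<open>Q\<^sub>t\<^sub>+\<^sub>1 - Q\<^sub>t - y\<^sup>\<star>\<close>, condition (v) and the descent lemma
  (with \<open>\<gamma> L \<le> \<lambda>\<close>, the smallest eigenvalue of \<open>D\<close>) make
  \<open>\<langle>y\<^sub>t - y\<^sup>\<star>, D (y\<^sub>t - y\<^sup>\<star>)\<rangle>/2 + \<langle>Q\<^sub>t, C Q\<^sub>t\<rangle>/2\<close> decrease by at least \<open>\<gamma> (F(y\<^sub>t\<^sub>+\<^sub>1) - F(y\<^sup>\<star>))\<close>.
  After telescoping, Young's inequality for the form \<open>C\<close> against \<open>q\<close> with \<open>C q = \<gamma> R v\<close>, where \<open>v\<close> is
  the disagreement \<open>p\<close> of the averaged iterate rescaled to length \<open>2 \<parallel>\<nabla>F(y\<^sup>\<star>)\<parallel>\<close>, yields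
  \<open>F(y\<^sub>a\<^sub>v\<^sub>g) - F(y\<^sup>\<star>) + 2 \<parallel>p\<parallel> \<parallel>\<nabla>F(y\<^sup>\<star>)\<parallel> \<le> c/k\<close>; such a \<open>q\<close> exists with a uniform bound because
  the range of \<open>C\<close> is the orthogonal complement of the consensus space. Convexity gives
  \<open>F(y\<^sub>a\<^sub>v\<^sub>g) - F(y\<^sup>\<star>) \<ge> - \<parallel>p\<parallel> \<parallel>\<nabla>F(y\<^sup>\<star>)\<parallel>\<close>, and both parts of the merit function follow.
\<close>

section \<open>Self-adjoint operators on a subspace\<close>

text \<open>Stationarity at a minimum without derivatives: a small \<open>t\<close> of sign opposite
  to \<open>a\<close> lets the linear term win.\<close>

lemma quadratic_nonneg_imp_linear_zero:
  fixes a b :: real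
  assumes "\<And>t. 0 \<le> t * a + t\<^sup>2 * b"
  shows "a = 0"
proof (rule ccontr)
  assume a: "a \<noteq> 0"
  define c where "c = \<bar>b\<bar> + 1"
  have c: "c > 0" "b < c" by (auto simp: c_def)
  \<comment> \<open>Since \<open>b < c\<close>, the step \<open>- a / c\<close> is short enough for
    the quadratic term not to make up for the linear loss.\<close>
  have "0 \<le> (- a / c) * a + (- a / c)\<^sup>2 * b" by (rule assms)
  also have "\<dots> = a\<^sup>2 / c * (b / c - 1)"
    using c by (simp add: field_simps power2_eq_square)
  also have "\<dots> < 0"
    using a c by (intro mult_pos_neg) (auto simp: field_simps)
  finally show False by simp
qed

text \<open>A maximiser of the Rayleigh quotient on the compact unit sphere of \<open>U\<close> is
  stationary in every direction of \<open>U\<close>. Its residual \<open>l *\<^sub>R e - T e\<close>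
  is then orthogonal to \<open>U\<close>, and it lies in \<open>U\<close>, so it vanishes.\<close>

lemma selfadjoint_eigenvector_exists:
  fixes T :: "'a::euclidean_space \<Rightarrow> 'a"
  assumes U: "subspace U" and T: "linear T" and TU: "\<And>x. x \<in> U \<Longrightarrow> T x \<in> U"
    and sym: "\<And>x y. x \<in> U \<Longrightarrow> y \<in> U \<Longrightarrow> T x \<bullet> y = x \<bullet> T y"
    and nz: "u \<in> U" "u \<noteq> 0"
  obtains e l where "e \<in> U" "norm e = 1" "T e = l *\<^sub>R e"
proof -
  let ?K = "U \<inter> sphere 0 1"
  have "compact ?K"
    using closed_subspace[OF U] by (simp add: closed_Int_compact)
  moreover have "?K \<noteq> {}"
  proof -
    have "(1 / norm u) *\<^sub>R u \<in> ?K"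
      using nz U by (auto simp: subspace_scale)
    then show ?thesis by blast
  qed
  moreover have "continuous_on ?K (\<lambda>x. T x \<bullet> x)"
    using linear_continuous_on[of T] T
    by (intro continuous_intros) (auto simp: linear_conv_bounded_linear)
  ultimately obtain e where e: "e \<in> ?K" and max: "\<And>x. x \<in> ?K \<Longrightarrow> T x \<bullet> x \<le> T e \<bullet> e"
    using continuous_attains_sup[of ?K "\<lambda>x. T x \<bullet> x"] by blast
  define l where "l = T e \<bullet> e"
  have eU: "e \<in> U" and ne: "norm e = 1" using e by auto
  have ee: "e \<bullet> e = 1" using ne by (simp add: norm_eq_1)
  have q: "T x \<bullet> x \<le> l * (x \<bullet> x)" if x: "x \<in> U" for x
  proof (cases "x = 0")
    case False
    let ?w = "(1 / norm x) *\<^sub>R x"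
    have "?w \<in> ?K" using False x U by (auto simp: subspace_scale)
    from max[OF this] have "(T x \<bullet> x) / (x \<bullet> x) \<le> l"
      using T False by (simp add: linear_scale l_def power2_norm_eq_inner[symmetric] power2_eq_square)
    then show ?thesis using False by (simp add: field_simps)
  qed (use T in \<open>simp add: linear_0\<close>)
  have "(l *\<^sub>R e - T e) \<bullet> h = 0" if h: "h \<in> U" for h
  proof -
    \<comment> \<open>The form \<open>l * (x \<bullet> x) - T x \<bullet> x\<close> is nonnegative
      on \<open>U\<close> and zero at \<open>e\<close>; this is its expansion at
      \<open>e + t *\<^sub>R h\<close>.\<close>
    have "0 \<le> t * (2 * ((l *\<^sub>R e - T e) \<bullet> h)) + t\<^sup>2 * (l * (h \<bullet> h) - T h \<bullet> h)" for t
    proof -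
      have "e + t *\<^sub>R h \<in> U" using eU h U by (simp add: subspace_add subspace_scale)
      from q[OF this] show ?thesis
        using sym[OF eU h] ee T
        by (simp add: linear_add linear_scale inner_add inner_diff l_def inner_commute
            algebra_simps power2_eq_square)
    qed
    from quadratic_nonneg_imp_linear_zero[OF this] show ?thesis by simp
  qed
  from this[of "l *\<^sub>R e - T e"] have "T e = l *\<^sub>R e"
    using eU TU U by (simp add: subspace_diff subspace_scale)
  then show thesis using that eU ne by blast
qed

text \<open>Induction on the dimension: after one eigenvector \<open>e\<close> is split off,
  symmetry makes its orthogonal complement in \<open>U\<close> invariant. Speaking of subspaces lets
  the induction pass to that complement.\<close>

theorem spectral_theorem_subspace:
  fixes T :: "'a::euclidean_space \<Rightarrow> 'a"
  assumes "subspace U" and "linear T" and "\<And>x. x \<in> U \<Longrightarrow> T x \<in> U"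
    and "\<And>x y. x \<in> U \<Longrightarrow> y \<in> U \<Longrightarrow> T x \<bullet> y = x \<bullet> T y"
  shows "\<exists>E l. finite E \<and> E \<subseteq> U \<and> pairwise orthogonal E \<and> (\<forall>e\<in>E. norm e = 1 \<and> T e = l e *\<^sub>R e)
           \<and> span E = U"
  using assms
proof (induction "dim U" arbitrary: U rule: less_induct)
  case less
  note U = less.prems(1) and T = less.prems(2) and TU = less.prems(3) and sym = less.prems(4)
  show ?case
  proof (cases "\<exists>u\<in>U. u \<noteq> 0")
    case False
    then have "U = {0}" using subspace_0[OF U] by auto
    then show ?thesis by (intro exI[of _ "{}"]) auto
  next
    case True
    then obtain e c where e: "e \<in> U" "norm e = 1" "T e = c *\<^sub>R e"
      using selfadjoint_eigenvector_exists[OF U T TU sym] by metis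
    have ee: "e \<bullet> e = 1" using e by (simp add: norm_eq_1)
    define W where "W = {x \<in> U. x \<bullet> e = 0}"
    have W: "subspace W"
      using U unfolding W_def subspace_def by (auto simp: inner_add_left)
    have WU: "W \<subseteq> U" by (auto simp: W_def)
    have "e \<notin> W" using ee by (simp add: W_def)
    then have dim: "dim W < dim U"
      using dim_psubset[of W U] e(1) WU W U by (metis psubsetI span_eq_iff)
    have TW: "T x \<in> W" if "x \<in> W" for x
      using that TU sym[of x e] e by (auto simp: W_def)
    have symW: "\<And>x y. x \<in> W \<Longrightarrow> y \<in> W \<Longrightarrow> T x \<bullet> y = x \<bullet> T y"
      using sym WU by blast
    obtain E l where E: "finite E" "E \<subseteq> W" "pairwise orthogonal E"
        "\<forall>x\<in>E. norm x = 1 \<and> T x = l x *\<^sub>R x" "span E = W"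
      using less.hyps[OF dim W T TW symW] by blast
    have eE: "e \<notin> E" using \<open>e \<notin> W\<close> E by blast
    have "span (insert e E) = U"
    proof
      show "span (insert e E) \<subseteq> U"
        using E WU e U by (intro span_minimal) auto
      show "U \<subseteq> span (insert e E)"
      proof
        fix x assume x: "x \<in> U"
        have "x - (x \<bullet> e) *\<^sub>R e \<in> W"
          using x e U ee by (auto simp: W_def subspace_diff subspace_scale inner_diff_left)
        then show "x \<in> span (insert e E)"
          using E span_breakdown_eq by blast
      qed
    qed
    moreover have "pairwise orthogonal (insert e E)"
      using E by (auto simp: pairwise_insert orthogonal_def W_def inner_commute)
    ultimately show ?thesis
      using E e WU eE
      by (intro exI[of _ "insert e E"] exI[of _ "l(e := c)"]) auto
  qed
qed

lemma orthonormal_inner: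
  assumes "pairwise orthogonal E" "\<forall>e\<in>E. norm e = 1" "e \<in> E" "e' \<in> E"
  shows "e \<bullet> e' = (if e = e' then 1 else 0)"
  using assms by (auto simp: pairwise_def orthogonal_def norm_eq_1)

text \<open>A vector orthogonal to the kernel has no component along eigenvectors of eigenvalue
  zero, so dividing its components by the eigenvalues inverts \<open>T\<close>. The bound
  \<open>K\<close> depends on \<open>T\<close> and \<open>U\<close> alone, not on
  \<open>v\<close>.\<close>

lemma selfadjoint_range_bounded_preimage:
  fixes T :: "'a::euclidean_space \<Rightarrow> 'a"
  assumes "subspace U" and T: "linear T" and "\<And>x. x \<in> U \<Longrightarrow> T x \<in> U"
    and "\<And>x y. x \<in> U \<Longrightarrow> y \<in> U \<Longrightarrow> T x \<bullet> y = x \<bullet> T y"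
  obtains K where "\<And>v. v \<in> U \<Longrightarrow> (\<And>x. x \<in> U \<Longrightarrow> T x = 0 \<Longrightarrow> v \<bullet> x = 0)
      \<Longrightarrow> \<exists>r\<in>U. T r = v \<and> norm r \<le> K * norm v"
proof -
  obtain E l where E: "finite E" "E \<subseteq> U" "pairwise orthogonal E"
      "\<forall>e\<in>E. norm e = 1 \<and> T e = l e *\<^sub>R e" "span E = U"
    using spectral_theorem_subspace[OF assms] by blast
  show thesis
  proof (rule that)
    fix v assume v: "v \<in> U" and orth: "\<And>x. x \<in> U \<Longrightarrow> T x = 0 \<Longrightarrow> v \<bullet> x = 0"
    \<comment> \<open>Division by zero gives 0, so kernel directions drop out of \<open>r\<close>,
      and likewise out of the norm bound.\<close>
    define r where "r = (\<Sum>e\<in>E. ((v \<bullet> e) / l e) *\<^sub>R e)"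
    have "r \<in> U"
      unfolding r_def using E assms(1) by (intro subspace_sum) (auto simp: subspace_scale)
    moreover have "T r = v"
    proof -
      have "T r = (\<Sum>e\<in>E. (v \<bullet> e) *\<^sub>R e)"
        unfolding r_def linear_sum[OF T] o_def
      proof (rule sum.cong[OF refl])
        fix e assume e: "e \<in> E"
        then show "T (((v \<bullet> e) / l e) *\<^sub>R e) = (v \<bullet> e) *\<^sub>R e"
          using E(2,4) orth[of e] T by (cases "l e = 0") (auto simp: linear_scale linear_0)
      qed
      also have "\<dots> = v"
        using E v by (intro orthonormal_basis_expand) auto
      finally show ?thesis .
    qed
    moreover have "norm r \<le> (\<Sum>e\<in>E. 1 / \<bar>l e\<bar>) * norm v"
      unfolding r_def sum_distrib_right
    proof (rule sum_norm_le)
      fix e assume e: "e \<in> E"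
      have "\<bar>v \<bullet> e\<bar> \<le> norm v" using E e Cauchy_Schwarz_ineq2[of v e] by simp
      then show "norm (((v \<bullet> e) / l e) *\<^sub>R e) \<le> 1 / \<bar>l e\<bar> * norm v"
        using E e by (simp add: divide_right_mono)
    qed
    ultimately show "\<exists>r\<in>U. T r = v \<and> norm r \<le> (\<Sum>e\<in>E. 1 / \<bar>l e\<bar>) * norm v" by blast
  qed
qed

section \<open>Square roots of positive semidefinite operators\<close>

text \<open>From the factorisation of \<open>T\<^sup>2 - c\<^sup>2\<close> as
  \<open>(T + c) (T - c)\<close>, the vector \<open>v = T x - c *\<^sub>R x\<close> satisfies
  \<open>T v = - c *\<^sub>R v\<close>, which positivity forbids for \<open>c > 0\<close> unless
  \<open>v = 0\<close>. Uniqueness of the root, its commutation and its fixed points all rest on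
  this.\<close>

lemma psd_eigenvector_of_square:
  fixes T :: "'a::real_inner \<Rightarrow> 'a"
  assumes T: "linear T" and TU: "\<And>x. x \<in> U \<Longrightarrow> T x \<in> U" and U: "subspace U"
    and sym: "\<And>x y. x \<in> U \<Longrightarrow> y \<in> U \<Longrightarrow> T x \<bullet> y = x \<bullet> T y"
    and psd: "\<And>x. x \<in> U \<Longrightarrow> 0 \<le> x \<bullet> T x"
    and x: "x \<in> U" and c: "0 \<le> c" and sq: "T (T x) = c\<^sup>2 *\<^sub>R x"
  shows "T x = c *\<^sub>R x"
proof (cases "c = 0")
  case True
  have "T x \<bullet> T x = x \<bullet> T (T x)" using sym x TU by metis
  then show ?thesis using True sq by simp
next
  case False
  define v where "v = T x - c *\<^sub>R x"
  have v: "v \<in> U" using x TU U by (simp add: v_def subspace_diff subspace_scale)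
  have "T v = - c *\<^sub>R v"
    using T sq by (simp add: v_def linear_diff linear_scale algebra_simps power2_eq_square)
  then have "0 \<le> - c * (v \<bullet> v)" using psd[OF v] by simp
  moreover have "0 < c" using c False by simp
  ultimately have "v \<bullet> v \<le> 0" by (simp add: mult_le_0_iff zero_le_mult_iff)
  then have "v = 0" by (metis inner_ge_zero inner_eq_zero_iff order_antisym)
  then show ?thesis by (simp add: v_def)
qed

lemma linear_eq_on_spanning_set:
  assumes "linear f" "linear g" "span E = U" "\<And>e. e \<in> E \<Longrightarrow> f e = g e" "x \<in> U"
  shows "f x = g x"
  using assms linear_eq_on_span by blast

lemma psd_sqrt_exists:
  fixes T :: "'a::euclidean_space \<Rightarrow> 'a"
  assumes "subspace U" and T: "linear T" and "\<And>x. x \<in> U \<Longrightarrow> T x \<in> U"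
    and "\<And>x y. x \<in> U \<Longrightarrow> y \<in> U \<Longrightarrow> T x \<bullet> y = x \<bullet> T y"
    and psd: "\<And>x. x \<in> U \<Longrightarrow> 0 \<le> x \<bullet> T x"
  obtains R where "linear R" "\<And>x. R x \<in> U" "\<And>x y. R x \<bullet> y = x \<bullet> R y" "\<And>x. 0 \<le> x \<bullet> R x"
    "\<And>x. x \<in> U \<Longrightarrow> R (R x) = T x"
proof -
  obtain E l where E: "finite E" "E \<subseteq> U" "pairwise orthogonal E"
      "\<forall>e\<in>E. norm e = 1 \<and> T e = l e *\<^sub>R e" "span E = U"
    using spectral_theorem_subspace[OF assms(1-4)] by blast
  \<comment> \<open>Defined on the whole space, \<open>R\<close> kills the orthogonal complement of
    \<open>U\<close>; range, symmetry and positivity thus hold for all arguments.\<close>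
  define R where "R x = (\<Sum>e\<in>E. (sqrt (l e) * (x \<bullet> e)) *\<^sub>R e)" for x
  have ortho: "e \<bullet> e' = (if e = e' then 1 else 0)" if "e \<in> E" "e' \<in> E" for e e'
    using orthonormal_inner[of E e e'] E that by blast
  have l: "0 \<le> l e" if "e \<in> E" for e
    using psd[of e] E that ortho[of e e] by auto
  have lin: "linear R"
    unfolding R_def
    by (rule linearI) (auto simp: inner_add_left algebra_simps sum.distrib scaleR_sum_right)
  have Re: "R e = sqrt (l e) *\<^sub>R e" if e: "e \<in> E" for e
  proof -
    have "R e = (\<Sum>e'\<in>E. if e' = e then sqrt (l e) *\<^sub>R e else 0)"
      unfolding R_def using ortho[OF e] by (intro sum.cong) auto
    then show ?thesis using E e by simp
  qed
  show thesis
  proof (rule that[of R, OF lin])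
    show "R x \<in> U" for x
      unfolding R_def using E assms(1) by (intro subspace_sum) (auto simp: subspace_scale)
    show "R x \<bullet> y = x \<bullet> R y" for x y
      unfolding R_def inner_sum_left inner_sum_right by (simp add: mult_ac inner_commute)
    show "0 \<le> x \<bullet> R x" for x
      unfolding R_def inner_sum_right using l by (auto intro!: sum_nonneg simp: mult.assoc)
    show "R (R x) = T x" if "x \<in> U" for x
    proof (rule linear_eq_on_spanning_set[of "\<lambda>x. R (R x)" T])
      show "linear (\<lambda>x. R (R x))" using linear_compose[OF lin lin] by (simp add: o_def)
      show "R (R e) = T e" if "e \<in> E" for e
        using that E l lin by (simp add: Re linear_scale)
    qed (use T E that in auto)
  qed
qed

text \<open>On an eigenvector of one root the common square acts as \<open>(l e)\<^sup>2\<close>, so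
  the other root, being positive, must act as \<open>l e\<close>.\<close>

lemma psd_sqrt_unique:
  fixes R R' :: "'a::euclidean_space \<Rightarrow> 'a"
  assumes U: "subspace U" and R: "linear R" "\<And>x. x \<in> U \<Longrightarrow> R x \<in> U"
    "\<And>x y. x \<in> U \<Longrightarrow> y \<in> U \<Longrightarrow> R x \<bullet> y = x \<bullet> R y" "\<And>x. x \<in> U \<Longrightarrow> 0 \<le> x \<bullet> R x"
    and R': "linear R'" "\<And>x. x \<in> U \<Longrightarrow> R' x \<in> U"
    "\<And>x y. x \<in> U \<Longrightarrow> y \<in> U \<Longrightarrow> R' x \<bullet> y = x \<bullet> R' y" "\<And>x. x \<in> U \<Longrightarrow> 0 \<le> x \<bullet> R' x"
    and eq: "\<And>x. x \<in> U \<Longrightarrow> R (R x) = R' (R' x)" and x: "x \<in> U"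
  shows "R x = R' x"
proof -
  obtain E l where E: "finite E" "E \<subseteq> U" "pairwise orthogonal E"
      "\<forall>e\<in>E. norm e = 1 \<and> R' e = l e *\<^sub>R e" "span E = U"
    using spectral_theorem_subspace[OF U R'(1-3)] by blast
  have "R e = R' e" if e: "e \<in> E" for e
  proof -
    have "0 \<le> l e" using E e R'(4)[of e] by (auto simp: norm_eq_1)
    moreover have "R (R e) = (l e)\<^sup>2 *\<^sub>R e"
      using eq[of e] E e R' by (auto simp: linear_scale power2_eq_square)
    ultimately have "R e = l e *\<^sub>R e"
      using psd_eigenvector_of_square[OF R(1,2) U R(3,4)] E e by blast
    then show ?thesis using E e by simp
  qed
  then show ?thesis using linear_eq_on_spanning_set[OF R(1) R'(1) E(5)] x by blast
qed

text \<open>If \<open>R e = l e *\<^sub>R e\<close>, commutation with the square gives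
  \<open>R (R (C e)) = (l e)\<^sup>2 *\<^sub>R C e\<close>, and positivity then yields
  \<open>R (C e) = l e *\<^sub>R C e\<close>.\<close>

lemma psd_sqrt_commutes:
  fixes R C :: "'a::euclidean_space \<Rightarrow> 'a"
  assumes U: "subspace U" and R: "linear R" "\<And>x. x \<in> U \<Longrightarrow> R x \<in> U"
    "\<And>x y. x \<in> U \<Longrightarrow> y \<in> U \<Longrightarrow> R x \<bullet> y = x \<bullet> R y" "\<And>x. x \<in> U \<Longrightarrow> 0 \<le> x \<bullet> R x"
    and C: "linear C" "\<And>x. x \<in> U \<Longrightarrow> C x \<in> U"
    and comm: "\<And>x. x \<in> U \<Longrightarrow> R (R (C x)) = C (R (R x))" and x: "x \<in> U"
  shows "R (C x) = C (R x)"
proof -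
  obtain E l where E: "finite E" "E \<subseteq> U" "pairwise orthogonal E"
      "\<forall>e\<in>E. norm e = 1 \<and> R e = l e *\<^sub>R e" "span E = U"
    using spectral_theorem_subspace[OF U R(1-3)] by blast
  have "R (C e) = C (R e)" if e: "e \<in> E" for e
  proof -
    have eU: "e \<in> U" using E e by auto
    have "0 \<le> l e" using E e R(4)[of e] by (auto simp: norm_eq_1)
    moreover have "R (R (C e)) = (l e)\<^sup>2 *\<^sub>R C e"
      using comm[OF eU] E e R C by (auto simp: linear_scale power2_eq_square)
    ultimately have "R (C e) = l e *\<^sub>R C e"
      using psd_eigenvector_of_square[OF R(1,2) U R(3,4) C(2)[OF eU]] by blast
    then show ?thesis using E e C by (simp add: linear_scale)
  qed
  then show ?thesis
    using linear_eq_on_spanning_set[OF linear_compose[OF C(1) R(1)] linear_compose[OF R(1) C(1)] E(5)] x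
    by (simp add: o_def)
qed

section \<open>Eigenvalues and quadratic forms\<close>

lemma selfadjoint_quadratic_form_ge:
  fixes T :: "'a::euclidean_space \<Rightarrow> 'a"
  assumes "subspace U" and T: "linear T" and "\<And>x. x \<in> U \<Longrightarrow> T x \<in> U"
    and "\<And>x y. x \<in> U \<Longrightarrow> y \<in> U \<Longrightarrow> T x \<bullet> y = x \<bullet> T y"
    and ev: "\<And>c v. v \<in> U \<Longrightarrow> v \<noteq> 0 \<Longrightarrow> T v = c *\<^sub>R v \<Longrightarrow> m \<le> c"
    and x: "x \<in> U"
  shows "m * (x \<bullet> x) \<le> x \<bullet> T x"
proof -
  obtain E l where E: "finite E" "E \<subseteq> U" "pairwise orthogonal E"
      "\<forall>e\<in>E. norm e = 1 \<and> T e = l e *\<^sub>R e" "span E = U"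
    using spectral_theorem_subspace[OF assms(1-4)] by blast
  have ml: "m \<le> l e" if "e \<in> E" for e
    using ev[of e "l e"] E that by force
  have exp: "x = (\<Sum>e\<in>E. (x \<bullet> e) *\<^sub>R e)"
    using orthonormal_basis_expand[of E x] E x by simp
  have "x \<bullet> T x = (\<Sum>e\<in>E. l e * (x \<bullet> e)\<^sup>2)"
  proof -
    have "T x = (\<Sum>e\<in>E. (x \<bullet> e) *\<^sub>R T e)"
      by (subst exp) (simp add: linear_sum[OF T] linear_scale[OF T] o_def)
    then show ?thesis using E by (simp add: inner_sum_right power2_eq_square mult_ac)
  qed
  moreover have "x \<bullet> x = (\<Sum>e\<in>E. (x \<bullet> e)\<^sup>2)"
    by (subst (2) exp) (simp add: inner_sum_right power2_eq_square)
  ultimately show ?thesis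
    using ml by (auto simp: sum_distrib_left intro!: sum_mono mult_right_mono)
qed

lemma selfadjoint_finite_eigenvalues:
  fixes T :: "'a::euclidean_space \<Rightarrow> 'a"
  assumes "subspace U" and T: "linear T" and "\<And>x. x \<in> U \<Longrightarrow> T x \<in> U"
    and sym: "\<And>x y. x \<in> U \<Longrightarrow> y \<in> U \<Longrightarrow> T x \<bullet> y = x \<bullet> T y"
  shows "finite {c. \<exists>v\<in>U. v \<noteq> 0 \<and> T v = c *\<^sub>R v}"
proof -
  obtain E l where E: "finite E" "E \<subseteq> U" "pairwise orthogonal E"
      "\<forall>e\<in>E. norm e = 1 \<and> T e = l e *\<^sub>R e" "span E = U"
    using spectral_theorem_subspace[OF assms] by blast
  have "c \<in> l ` E" if v: "v \<in> U" "v \<noteq> 0" "T v = c *\<^sub>R v" for c v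
  proof (rule ccontr)
    assume c: "c \<notin> l ` E"
    have "v \<bullet> e = 0" if e: "e \<in> E" for e
    proof -
      have "c * (v \<bullet> e) = l e * (v \<bullet> e)"
        using sym[of v e] v E e by auto
      then show ?thesis using c e by auto
    qed
    moreover have "v = (\<Sum>e\<in>E. (v \<bullet> e) *\<^sub>R e)"
      using orthonormal_basis_expand[of E v] E v by simp
    ultimately show False using v by simp
  qed
  then have "{c. \<exists>v\<in>U. v \<noteq> 0 \<and> T v = c *\<^sub>R v} \<subseteq> l ` E" by blast
  then show ?thesis using E finite_surj by blast
qed

section \<open>Indexed matrices as operators\<close>

text \<open>Zero padding carries functions that matter only on \<open>S\<close> into one Euclidean
  space, where agreement on \<open>S\<close> becomes equality and the operator results apply with
  \<open>U = supp_space S\<close>.\<close>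

definition vec_on :: "'n set \<Rightarrow> ('n \<Rightarrow> real) \<Rightarrow> real ^ 'n::finite" where
  "vec_on S v = (\<chi> j. if j \<in> S then v j else 0)"

definition supp_space :: "'n set \<Rightarrow> (real ^ 'n::finite) set" where
  "supp_space S = {x. \<forall>j. j \<notin> S \<longrightarrow> x $ j = 0}"

definition mat_op :: "'n set \<Rightarrow> ('n \<Rightarrow> 'n \<Rightarrow> real) \<Rightarrow> real ^ 'n \<Rightarrow> real ^ 'n::finite" where
  "mat_op S M x = vec_on S (mat_vec S M (\<lambda>j. x $ j))"

lemma vec_on_nth: "vec_on S v $ j = (if j \<in> S then v j else 0)"
  by (simp add: vec_on_def)

lemma vec_on_in_supp_space [simp]: "vec_on S v \<in> supp_space S"
  by (simp add: vec_on_def supp_space_def)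

lemma vec_on_cong: "(\<And>x. x \<in> S \<Longrightarrow> v x = w x) \<Longrightarrow> vec_on S v = vec_on S w"
  by (simp add: vec_on_def vec_eq_iff)

lemma subspace_supp_space: "subspace (supp_space S)"
  by (simp add: subspace_def supp_space_def)

lemma vec_on_inner: "vec_on S v \<bullet> x = (\<Sum>j\<in>S. v j * x $ j)"
proof -
  have "vec_on S v \<bullet> x = (\<Sum>j\<in>UNIV. if j \<in> S then v j * x $ j else 0)"
    unfolding inner_vec_def by (intro sum.cong) (auto simp: vec_on_nth)
  then show ?thesis by (simp add: sum.If_cases)
qed

lemma norm_vec_on: "norm (vec_on S v) = vnorm S v"
  by (simp add: norm_eq_sqrt_inner vec_on_inner vnorm_def vec_on_nth power2_eq_square)

lemma mat_op_vec_on: "mat_op S M (vec_on S v) = vec_on S (mat_vec S M v)"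
  by (auto simp: mat_op_def mat_vec_def vec_on_def vec_eq_iff intro!: sum.cong)

lemma mat_op_nth: "mat_op S M x $ j = (if j \<in> S then (\<Sum>k\<in>S. M j k * x $ k) else 0)"
  by (simp add: mat_op_def vec_on_nth mat_vec_def)

lemma mat_op_in_supp_space [simp]: "mat_op S M x \<in> supp_space S"
  by (simp add: mat_op_def)

lemma linear_mat_op: "linear (mat_op S M)"
  by (rule linearI) (auto simp: vec_eq_iff mat_op_nth algebra_simps sum.distrib sum_distrib_left)

lemma inner_mat_op: "y \<bullet> mat_op S M x = (\<Sum>j\<in>S. y $ j * mat_vec S M (\<lambda>j. x $ j) j)"
  unfolding mat_op_def by (subst inner_commute) (simp add: vec_on_inner mult.commute)

lemma mat_op_selfadjoint:
  assumes "mat_sym S M"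
  shows "mat_op S M x \<bullet> y = x \<bullet> mat_op S M y"
proof -
  have "mat_op S M x \<bullet> y = (\<Sum>j\<in>S. \<Sum>k\<in>S. y $ j * (M j k * x $ k))"
    by (subst inner_commute) (simp add: inner_mat_op mat_vec_def sum_distrib_left)
  also have "\<dots> = (\<Sum>k\<in>S. \<Sum>j\<in>S. y $ j * (M j k * x $ k))"
    by (rule sum.swap)
  also have "\<dots> = x \<bullet> mat_op S M y"
    using assms unfolding inner_mat_op mat_vec_def sum_distrib_left mat_sym_def
    by (intro sum.cong) auto
  finally show ?thesis .
qed

lemma mat_op_psd: "mat_psd S M \<Longrightarrow> 0 \<le> x \<bullet> mat_op S M x"
  by (simp add: mat_psd_def inner_mat_op)

lemma mat_op_mult: "mat_op S (mat_mult S M N) x = mat_op S M (mat_op S N x)"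
proof -
  have "(\<Sum>k\<in>S. (\<Sum>y\<in>S. M j y * N y k) * x $ k) = (\<Sum>y\<in>S. M j y * (\<Sum>k\<in>S. N y k * x $ k))" for j
    unfolding sum_distrib_left sum_distrib_right by (subst sum.swap) (simp add: mult.assoc)
  then show ?thesis by (simp add: vec_eq_iff mat_op_nth mat_mult_def)
qed

lemma mat_op_axis: "j \<in> S \<Longrightarrow> k \<in> S \<Longrightarrow> mat_op S M (axis k 1) $ j = M j k"
  by (simp add: mat_op_nth axis_def if_distrib cong: if_cong)

lemma axis_in_supp_space: "k \<in> S \<Longrightarrow> axis k c \<in> supp_space S"
  by (auto simp: supp_space_def axis_def)

lemma mat_eq_iff_mat_op: "mat_eq S M N \<longleftrightarrow> (\<forall>x\<in>supp_space S. mat_op S M x = mat_op S N x)"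
proof
  assume "mat_eq S M N"
  then show "\<forall>x\<in>supp_space S. mat_op S M x = mat_op S N x"
    by (simp add: mat_eq_def vec_eq_iff mat_op_nth)
next
  assume *: "\<forall>x\<in>supp_space S. mat_op S M x = mat_op S N x"
  show "mat_eq S M N"
    unfolding mat_eq_def by (metis * axis_in_supp_space mat_op_axis)
qed

text \<open>The way back from operators to matrices: the root is built as an operator, whereas
  \<open>mat_sqrt\<close> describes a matrix.\<close>

lemma mat_op_matrix:
  assumes T: "linear T" and TS: "\<And>x. T x \<in> supp_space S" and x: "x \<in> supp_space S"
  shows "mat_op S (\<lambda>j k. if j \<in> S \<and> k \<in> S then T (axis k 1) $ j else 0) x = T x"
proof -
  have "x = (\<Sum>k\<in>UNIV. x $ k *\<^sub>R axis k 1)"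
    by (simp add: vec_eq_iff axis_def if_distrib cong: if_cong)
  also have "\<dots> = (\<Sum>k\<in>S. x $ k *\<^sub>R axis k 1)"
    using x by (intro sum.mono_neutral_right) (auto simp: supp_space_def)
  finally have "T x = (\<Sum>k\<in>S. x $ k *\<^sub>R T (axis k 1))"
    by (metis (mono_tags, lifting) T linear_scale linear_sum sum.cong)
  then show ?thesis
    using TS by (auto simp: vec_eq_iff mat_op_nth supp_space_def mult.commute)
qed

lemma mat_psdI_mat_op:
  assumes sym: "\<And>x y. x \<in> supp_space S \<Longrightarrow> y \<in> supp_space S \<Longrightarrow> mat_op S M x \<bullet> y = x \<bullet> mat_op S M y"
    and psd: "\<And>x. x \<in> supp_space S \<Longrightarrow> 0 \<le> x \<bullet> mat_op S M x"
  shows "mat_psd S M"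
  unfolding mat_psd_def
proof (intro conjI allI)
  show "mat_sym S M"
    unfolding mat_sym_def
  proof (intro ballI)
    fix j k assume "j \<in> S" "k \<in> S"
    then show "M j k = M k j"
      using sym[of "axis j 1" "axis k 1"]
      by (simp add: axis_in_supp_space inner_axis inner_axis' mat_op_axis)
  qed
  fix v
  have "vec_on S v \<bullet> mat_op S M (vec_on S v) = (\<Sum>x\<in>S. v x * mat_vec S M v x)"
    by (simp add: mat_op_vec_on vec_on_inner vec_on_nth)
  then show "0 \<le> (\<Sum>x\<in>S. v x * mat_vec S M v x)"
    using psd[of "vec_on S v"] by simp
qed

text \<open>The \<open>THE\<close> in \<open>mat_sqrt\<close> requires existence and uniqueness,
  both transported from operators. Uniqueness holds for functions, not just on \<open>S\<close>,
  because candidates vanish outside \<open>S\<close>.\<close>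

lemma mat_sqrt_properties:
  fixes M :: "'n::finite \<Rightarrow> 'n \<Rightarrow> real"
  assumes M: "mat_psd S M"
  shows "mat_psd S (mat_sqrt S M)" "mat_eq S (mat_mult S (mat_sqrt S M) (mat_sqrt S M)) M"
proof -
  let ?U = "supp_space S"
  let ?P = "\<lambda>R. mat_psd S R \<and> (\<forall>x y. (x \<notin> S \<or> y \<notin> S) \<longrightarrow> R x y = 0) \<and> mat_eq S (mat_mult S R R) M"
  have sym: "mat_sym S M" using M by (simp add: mat_psd_def)
  obtain T where T: "linear T" "\<And>x. T x \<in> ?U" "\<And>x y. T x \<bullet> y = x \<bullet> T y" "\<And>x. 0 \<le> x \<bullet> T x"
      "\<And>x. x \<in> ?U \<Longrightarrow> T (T x) = mat_op S M x"
    by (rule psd_sqrt_exists[OF subspace_supp_space linear_mat_op mat_op_in_supp_space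
          mat_op_selfadjoint[OF sym] mat_op_psd[OF M]]) blast
  define R where "R = (\<lambda>j k. if j \<in> S \<and> k \<in> S then T (axis k 1) $ j else 0)"
  have RT: "mat_op S R x = T x" if "x \<in> ?U" for x
    unfolding R_def using mat_op_matrix T that by blast
  have PR: "?P R"
    using T RT by (auto simp: mat_eq_iff_mat_op mat_op_mult R_def intro: mat_psdI_mat_op)
  have uniq: "R' = R" if R': "?P R'" for R'
  proof -
    have symR: "mat_sym S R" "mat_sym S R'" using PR R' by (auto simp: mat_psd_def)
    have "mat_op S R' x = mat_op S R x" if "x \<in> ?U" for x
    proof (rule psd_sqrt_unique[OF subspace_supp_space, where x = x])
      show "mat_op S R' (mat_op S R' x) = mat_op S R (mat_op S R x)" if "x \<in> ?U" for x
        using that PR R' by (simp add: mat_eq_iff_mat_op mat_op_mult)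
    qed (use that symR PR R' in \<open>auto simp: linear_mat_op mat_op_selfadjoint mat_op_psd\<close>)
    then have "mat_eq S R' R" by (simp add: mat_eq_iff_mat_op)
    then show ?thesis
      using R' PR by (intro ext) (metis mat_eq_def)
  qed
  have "?P (mat_sqrt S M)"
    unfolding mat_sqrt_def using PR uniq by (rule theI)
  then show "mat_psd S (mat_sqrt S M)" "mat_eq S (mat_mult S (mat_sqrt S M) (mat_sqrt S M)) M"
    by auto
qed

lemma mat_eigenvalues_mat_op:
  "mat_eigenvalues S M = {c. \<exists>v\<in>supp_space S. v \<noteq> 0 \<and> mat_op S M v = c *\<^sub>R v}"
proof -
  have "(\<exists>v. (\<exists>x\<in>S. v x \<noteq> 0) \<and> (\<forall>x\<in>S. mat_vec S M v x = c * v x)) \<longleftrightarrow>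
        (\<exists>v\<in>supp_space S. v \<noteq> 0 \<and> mat_op S M v = c *\<^sub>R v)" (is "?l \<longleftrightarrow> ?r") for c
  proof
    assume ?l
    then obtain v where "\<exists>x\<in>S. v x \<noteq> 0" "\<forall>x\<in>S. mat_vec S M v x = c * v x" by blast
    then show ?r
      by (intro bexI[of _ "vec_on S v"]) (auto simp: mat_op_vec_on vec_eq_iff vec_on_nth)
  next
    assume ?r
    then obtain v where v: "v \<in> supp_space S" "v \<noteq> 0" "mat_op S M v = c *\<^sub>R v" by blast
    have "mat_vec S M (\<lambda>j. v $ j) x = c * v $ x" if "x \<in> S" for x
      using arg_cong[OF v(3), of "\<lambda>w. w $ x"] that by (simp add: mat_op_def vec_on_nth)
    moreover have "\<exists>x\<in>S. v $ x \<noteq> 0"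
      using v(1,2) by (auto simp: vec_eq_iff supp_space_def)
    ultimately show ?l by blast
  qed
  then show ?thesis by (simp add: mat_eigenvalues_def)
qed

lemma lambda_min_le_quadratic_form:
  assumes "mat_sym S M" "x \<in> supp_space S"
  shows "lambda_min S M * (x \<bullet> x) \<le> x \<bullet> mat_op S M x"
proof (rule selfadjoint_quadratic_form_ge[OF subspace_supp_space linear_mat_op])
  have "finite (mat_eigenvalues S M)"
    unfolding mat_eigenvalues_mat_op
    by (rule selfadjoint_finite_eigenvalues[OF subspace_supp_space linear_mat_op])
       (auto simp: mat_op_selfadjoint[OF assms(1)])
  then show "lambda_min S M \<le> c" if "v \<in> supp_space S" "v \<noteq> 0" "mat_op S M v = c *\<^sub>R v" for c v
    unfolding lambda_min_def using that by (intro Min_le) (auto simp: mat_eigenvalues_mat_op)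
qed (use assms in \<open>auto simp: mat_op_selfadjoint\<close>)

section \<open>Smooth convex functions\<close>

text \<open>Riesz representation: the values of the derivative on \<open>Basis\<close> are the
  coordinates of the one vector that \<open>THE\<close> can select.\<close>

lemma has_derivative_grad:
  fixes f :: "real ^ 'k \<Rightarrow> real"
  assumes "f differentiable (at x)"
  shows "(f has_derivative (\<lambda>h. grad f x \<bullet> h)) (at x)"
proof -
  obtain f' where f': "(f has_derivative f') (at x)"
    using assms by (auto simp: differentiable_def)
  define g where "g = (\<Sum>b\<in>Basis. f' b *\<^sub>R b)"
  have lin: "linear f'" using f' has_derivative_linear by blast
  have "f' h = g \<bullet> h" for h
  proof -
    have "f' h = f' (\<Sum>b\<in>Basis. (h \<bullet> b) *\<^sub>R b)" by (simp add: euclidean_representation)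
    also have "\<dots> = (\<Sum>b\<in>Basis. (h \<bullet> b) * f' b)"
      by (simp add: linear_sum[OF lin] linear_scale[OF lin] o_def)
    also have "\<dots> = g \<bullet> h"
      unfolding g_def inner_sum_left by (simp add: mult.commute inner_commute)
    finally show ?thesis .
  qed
  then have g: "(f has_derivative (\<lambda>h. g \<bullet> h)) (at x)" using f' by (metis ext)
  have "g' = g" if "(f has_derivative (\<lambda>h. g' \<bullet> h)) (at x)" for g'
    using has_derivative_unique[OF that g] by (metis vector_eq_rdot)
  with g show ?thesis unfolding grad_def by (rule theI)
qed

lemma DERIV_along_line:
  fixes f :: "real ^ 'k \<Rightarrow> real"
  assumes "\<And>x. f differentiable (at x)"
  shows "((\<lambda>t. f (a + t *\<^sub>R h)) has_real_derivative grad f (a + t *\<^sub>R h) \<bullet> h) (at t)"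
proof -
  have "((\<lambda>t. a + t *\<^sub>R h) has_derivative (\<lambda>s. s *\<^sub>R h)) (at t)"
    by (auto intro!: derivative_eq_intros)
  from diff_chain_at[OF this has_derivative_grad[OF assms]]
  have "((\<lambda>t. f (a + t *\<^sub>R h)) has_derivative (\<lambda>s. s * (grad f (a + t *\<^sub>R h) \<bullet> h))) (at t)"
    by (simp add: o_def)
  then show ?thesis
    by (rule has_derivative_imp_has_field_derivative) simp
qed

text \<open>Along the segment, \<open>f\<close> minus its quadratic majorant has nonpositive
  derivative by Cauchy-Schwarz and the Lipschitz bound; comparing \<open>\<phi> 1\<close> with
  \<open>\<phi> 0\<close> replaces integration of the gradient.\<close>

lemma L_smooth_descent:
  fixes f :: "real ^ 'k \<Rightarrow> real"
  assumes "L_smooth L f"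
  shows "f b \<le> f a + grad f a \<bullet> (b - a) + L / 2 * ((b - a) \<bullet> (b - a))"
proof -
  define h where "h = b - a"
  have diff: "\<And>x. f differentiable (at x)"
    and lip: "\<And>x y. norm (grad f x - grad f y) \<le> L * norm (x - y)"
    using assms by (auto simp: L_smooth_def)
  define \<phi> where "\<phi> t = f (a + t *\<^sub>R h) - t * (grad f a \<bullet> h) - L / 2 * t\<^sup>2 * (h \<bullet> h)" for t
  have "\<phi> 1 \<le> \<phi> 0"
  proof (rule DERIV_nonpos_imp_nonincreasing[of 0 1 \<phi>])
    fix t :: real assume t: "0 \<le> t"
    have "(\<phi> has_real_derivative (grad f (a + t *\<^sub>R h) \<bullet> h - grad f a \<bullet> h - L * t * (h \<bullet> h))) (at t)"
      unfolding \<phi>_def by (auto intro!: derivative_eq_intros DERIV_along_line[OF diff])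
    moreover have "grad f (a + t *\<^sub>R h) \<bullet> h - grad f a \<bullet> h - L * t * (h \<bullet> h) \<le> 0"
    proof -
      have "(grad f (a + t *\<^sub>R h) - grad f a) \<bullet> h \<le> norm (grad f (a + t *\<^sub>R h) - grad f a) * norm h"
        by (rule norm_cauchy_schwarz)
      also have "\<dots> \<le> (L * norm (t *\<^sub>R h)) * norm h"
        using lip[of "a + t *\<^sub>R h" a] by (intro mult_right_mono) auto
      also have "\<dots> = L * t * (h \<bullet> h)"
        using t by (simp add: power2_norm_eq_inner[symmetric] power2_eq_square)
      finally show ?thesis by (simp add: inner_diff_left)
    qed
    ultimately show "\<exists>y. (\<phi> has_real_derivative y) (at t) \<and> y \<le> 0" by blast
  qed simp
  then show ?thesis by (simp add: \<phi>_def h_def)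
qed

lemma convex_above_tangent_grad:
  fixes f :: "real ^ 'k \<Rightarrow> real"
  assumes conv: "convex_on UNIV f" and diff: "\<And>x. f differentiable (at x)"
  shows "f a + grad f a \<bullet> (b - a) \<le> f b"
proof -
  define \<phi> where "\<phi> t = f (a + t *\<^sub>R (b - a))" for t
  have "convex_on UNIV \<phi>"
  proof (rule convex_onI)
    fix t x y :: real assume t: "0 < t" "t < 1"
    have "a + ((1 - t) *\<^sub>R x + t *\<^sub>R y) *\<^sub>R (b - a)
        = (1 - t) *\<^sub>R (a + x *\<^sub>R (b - a)) + t *\<^sub>R (a + y *\<^sub>R (b - a))"
      by (simp add: algebra_simps)
    then show "\<phi> ((1 - t) *\<^sub>R x + t *\<^sub>R y) \<le> (1 - t) * \<phi> x + t * \<phi> y"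
      unfolding \<phi>_def using convex_onD[OF conv, of t] t by simp
  qed simp
  moreover have "(\<phi> has_real_derivative grad f a \<bullet> (b - a)) (at 0)"
    unfolding \<phi>_def using DERIV_along_line[OF diff, of a "b - a" 0] by simp
  ultimately have "\<phi> 1 - \<phi> 0 \<ge> (grad f a \<bullet> (b - a)) * (1 - 0)"
    by (intro convex_on_imp_above_tangent[of UNIV]) auto
  then show ?thesis by (simp add: \<phi>_def)
qed

section \<open>The iteration in an abstract Euclidean space\<close>

text \<open>Separates the convergence argument from stacked indices. \<open>R\<close> is the root of
  \<open>B\<close>, so \<open>B\<close> appears as \<open>R\<close> applied twice and
  \<open>A\<close> as \<open>R (R (D x))\<close>. \<open>gap\<close> is condition (v) as a quadratic
  form; convexity and smoothness enter through \<open>F_lower\<close> and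
  \<open>F_upper\<close>.\<close>

locale abc_iteration =
  fixes U :: "'a::euclidean_space set" and R C D :: "'a \<Rightarrow> 'a" and F :: "'a \<Rightarrow> real" and G :: "'a \<Rightarrow> 'a"
    and L \<gamma> m :: real and ystar :: 'a and y z :: "nat \<Rightarrow> 'a"
  assumes U: "subspace U"
    and R_linear: "linear R" and C_linear: "linear C" and D_linear: "linear D"
    and R_mem: "\<And>x. R x \<in> U" and C_mem: "\<And>x. C x \<in> U"
    and R_sym: "\<And>x y. R x \<bullet> y = x \<bullet> R y" and C_sym: "\<And>x y. C x \<bullet> y = x \<bullet> C y"
    and D_sym: "\<And>x y. D x \<bullet> y = x \<bullet> D y"
    and C_psd: "\<And>x. 0 \<le> x \<bullet> C x"
    and D_lower: "\<And>x. x \<in> U \<Longrightarrow> m * (x \<bullet> x) \<le> x \<bullet> D x"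
    and RC: "\<And>x. x \<in> U \<Longrightarrow> R (C x) = C (R x)"
    and gap: "\<And>x. x \<in> U \<Longrightarrow> (x \<bullet> C x) / 2 + R x \<bullet> D (R x) \<le> x \<bullet> x"
    and ystar_mem: "ystar \<in> U" and C_ystar: "C ystar = 0" and R_ystar: "R ystar = ystar"
    and D_ystar: "D ystar = ystar"
    and F_upper: "\<And>a b. F b \<le> F a + G a \<bullet> (b - a) + L / 2 * ((b - a) \<bullet> (b - a))"
    and F_lower: "\<And>a b. F a + G a \<bullet> (b - a) \<le> F b"
    and optimality: "\<And>x. x \<in> U \<Longrightarrow> C x = 0 \<Longrightarrow> G ystar \<bullet> x = 0"
    and L_nonneg: "0 \<le> L" and gamma_pos: "0 < \<gamma>" and gamma_le: "\<gamma> * L \<le> m"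
    and y0: "y 0 \<in> U" and z0: "z 0 = 0"
    and y_Suc: "\<And>t. y (Suc t) = R (R (D (y t) - \<gamma> *\<^sub>R G (y t))) - z t"
    and z_Suc: "\<And>t. z (Suc t) = z t + C (y (Suc t))"
begin

text \<open>\<open>Q\<close> accumulates preimages of the iterates, so that \<open>R (Q (Suc t) - Q t) = y (Suc t)\<close> and \<open>z t = R (C (Q t))\<close>.\<close>
primrec Q :: "nat \<Rightarrow> 'a" where
  "Q 0 = 0"
| "Q (Suc t) = Q t + (R (D (y t) - \<gamma> *\<^sub>R G (y t)) - C (Q t))"

lemma Q_mem: "Q t \<in> U"
  using U R_mem C_mem by (induction t) (auto simp: subspace_0 subspace_add subspace_diff)

text \<open>The two identities need each other: the one for \<open>y\<close> turns the increment of
  \<open>z\<close> into \<open>C (R (Q (Suc t) - Q t))\<close>, where \<open>C\<close> moves past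
  \<open>R\<close> and the sum telescopes; the new \<open>z\<close> then gives the next
  \<open>y\<close>.\<close>

lemma z_eq_y_eq: "z t = R (C (Q t)) \<and> y (Suc t) = R (Q (Suc t) - Q t)"
proof (induction t)
  case 0
  show ?case
    using z0 y_Suc[of 0] R_linear C_linear by (simp add: linear_0)
next
  case (Suc t)
  have d: "Q (Suc t) - Q t \<in> U" using Q_mem U by (blast intro: subspace_diff)
  have "z (Suc t) = R (C (Q t)) + R (C (Q (Suc t) - Q t))"
    using Suc z_Suc[of t] RC[OF d] by (simp del: Q.simps)
  also have "\<dots> = R (C (Q (Suc t)))"
    using R_linear C_linear by (simp add: linear_diff del: Q.simps)
  finally have z: "z (Suc t) = R (C (Q (Suc t)))" .
  have "Q (Suc (Suc t)) - Q (Suc t) = R (D (y (Suc t)) - \<gamma> *\<^sub>R G (y (Suc t))) - C (Q (Suc t))"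
    by (subst Q.simps(2)[of "Suc t"]) simp
  then have "R (Q (Suc (Suc t)) - Q (Suc t)) = y (Suc (Suc t))"
    using y_Suc[of "Suc t"] z R_linear by (simp add: linear_diff del: Q.simps)
  with z show ?case by simp
qed

lemma y_Suc_eq: "y (Suc t) = R (Q (Suc t) - Q t)"
  using z_eq_y_eq by blast

lemma y_mem: "y t \<in> U"
  by (cases t) (use y0 y_Suc_eq R_mem in auto)

text \<open>Telescoping from \<open>Q 0 = 0\<close>. The sum starts at 1 because \<open>y 0\<close>
  is arbitrary in \<open>U\<close> and may lie outside the range of \<open>R\<close>.\<close>

lemma sum_y_eq: "(\<Sum>t=1..k. y t) = R (Q k)"
proof (induction k)
  case (Suc k)
  then show ?case
    using R_linear y_Suc_eq[of k] by (simp add: linear_diff del: Q.simps)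
qed (use R_linear in \<open>simp add: linear_0\<close>)

lemma D_psd: "x \<in> U \<Longrightarrow> 0 \<le> x \<bullet> D x"
proof -
  assume "x \<in> U"
  moreover have "0 \<le> m"
    using L_nonneg gamma_pos gamma_le by (meson mult_nonneg_nonneg less_imp_le order_trans)
  ultimately show ?thesis
    using D_lower[of x] by (meson inner_ge_zero mult_nonneg_nonneg order_trans)
qed

section \<open>Decrease of the energy along the iteration\<close>

definition energy :: "nat \<Rightarrow> real" where
  "energy t = (y t - ystar) \<bullet> D (y t - ystar) / 2 + Q t \<bullet> C (Q t) / 2"

lemma energy_descent: "\<gamma> * (F (y (Suc t)) - F ystar) + energy (Suc t) \<le> energy t"
proof -
  define u where "u = Q (Suc t) - Q t"
  define y' where "y' = y (Suc t)"
  define e where "e = y' - ystar"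
  define d where "d = y' - y t"
  have u_mem: "u \<in> U" using Q_mem U by (auto simp: u_def subspace_diff simp del: Q.simps)
  have Ru: "R u = y'" by (simp add: u_def y'_def y_Suc_eq del: Q.simps)
  have Q': "Q (Suc t) = Q t + u" by (simp add: u_def)
  have u_eq: "u = R (D (y t)) - \<gamma> *\<^sub>R R (G (y t)) - C (Q t)"
    using R_linear by (simp add: u_def linear_diff linear_scale)
  have Re: "R (u - ystar) = e"
    using R_linear by (simp add: linear_diff Ru R_ystar e_def)
  have eU: "e \<in> U" "d \<in> U"
    using y_mem ystar_mem U by (auto simp: e_def d_def y'_def subspace_diff)
  have C_diff: "C (u - ystar) = C u" using C_linear by (simp add: linear_diff C_ystar)
  have star_C: "ystar \<bullet> C x = 0" for x using C_sym[of ystar x] C_ystar by simp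
  \<comment> \<open>Condition (v) at \<open>u - ystar\<close>, which \<open>R\<close> maps to the
    error \<open>e\<close>; \<open>ystar\<close> disappears from the \<open>C\<close> term because
    it lies in the kernel.\<close>
  have "u \<bullet> C u / 2 + e \<bullet> D e \<le> (u - ystar) \<bullet> (u - ystar)"
    using gap[of "u - ystar"] u_mem ystar_mem U
    by (simp add: subspace_diff Re C_diff inner_diff_left star_C)
  moreover have "ystar \<bullet> (u - ystar) = D ystar \<bullet> e"
    using R_sym[of ystar "u - ystar"] by (simp add: R_ystar Re D_ystar)
  moreover have "D y' \<bullet> e = e \<bullet> D e + D ystar \<bullet> e"
    using D_linear by (simp add: e_def linear_diff algebra_simps inner_commute)
  moreover have "u \<bullet> (u - ystar) = (u - ystar) \<bullet> (u - ystar) + ystar \<bullet> (u - ystar)"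
    by (simp add: inner_diff_left)
  ultimately have lower: "u \<bullet> C u / 2 + D y' \<bullet> e \<le> u \<bullet> (u - ystar)" by linarith
  \<comment> \<open>The same pairing, now evaluated through the update of \<open>Q\<close>; shifting
    \<open>R\<close> to the right factor produces \<open>e\<close>. Compared with
    \<open>lower\<close>, only the increment \<open>d\<close> remains under
    \<open>D\<close>.\<close>
  have "u \<bullet> (u - ystar) = R (D (y t)) \<bullet> (u - ystar) - \<gamma> * (R (G (y t)) \<bullet> (u - ystar)) - C (Q t) \<bullet> (u - ystar)"
    by (subst (1) u_eq) (simp add: inner_diff_left)
  also have "\<dots> = D (y t) \<bullet> e - \<gamma> * (G (y t) \<bullet> e) - Q t \<bullet> C u"
    by (simp only: R_sym Re C_sym C_diff)
  finally have main: "D d \<bullet> e + \<gamma> * (G (y t) \<bullet> e) + Q t \<bullet> C u + u \<bullet> C u / 2 \<le> 0"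
    using lower D_linear by (simp add: d_def linear_diff inner_diff_left)
  \<comment> \<open>\<open>QC\<close> and \<open>DD\<close> turn the cross terms of
    \<open>main\<close> into increments of the two halves of \<open>energy\<close>, leaving a spare
    \<open>d \<bullet> D d / 2\<close> to absorb the smoothness error.\<close>
  have QC: "Q (Suc t) \<bullet> C (Q (Suc t)) / 2 - Q t \<bullet> C (Q t) / 2 = Q t \<bullet> C u + u \<bullet> C u / 2"
    using C_linear C_sym[of "Q t" u] unfolding Q'
    by (simp add: linear_add inner_add inner_commute field_simps)
  have yt: "y t - ystar = e - d" by (simp add: e_def d_def)
  have DD: "e \<bullet> D e / 2 - (e - d) \<bullet> D (e - d) / 2 = D d \<bullet> e - d \<bullet> D d / 2"
    using D_linear D_sym[of d e] D_sym[of e d]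
    by (simp add: linear_diff inner_diff inner_commute field_simps)
  \<comment> \<open>The step size restriction enters here.\<close>
  have "\<gamma> * L * (d \<bullet> d) \<le> d \<bullet> D d"
    using gamma_le D_lower[OF eU(2)] by (meson inner_ge_zero mult_right_mono order_trans)
  moreover have "\<gamma> * (F y' - F ystar) \<le> \<gamma> * (G (y t) \<bullet> e + L / 2 * (d \<bullet> d))"
  proof -
    \<comment> \<open>Upper model at \<open>y'\<close> and tangent bound at \<open>ystar\<close>
      share the base point \<open>y t\<close>, so their linear parts merge into
      \<open>G (y t) \<bullet> e\<close>.\<close>
    have "F y' - F ystar \<le> G (y t) \<bullet> (y' - y t) + L / 2 * (d \<bullet> d) - G (y t) \<bullet> (ystar - y t)"
      using F_upper[of y' "y t"] F_lower[of "y t" ystar] by (simp add: d_def)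
    also have "\<dots> = G (y t) \<bullet> e + L / 2 * (d \<bullet> d)"
      by (simp add: e_def inner_diff_right)
    finally show ?thesis using gamma_pos by simp
  qed
  ultimately have "\<gamma> * (F y' - F ystar) \<le> \<gamma> * (G (y t) \<bullet> e) + d \<bullet> D d / 2"
    by (simp add: algebra_simps)
  moreover have "energy (Suc t) - energy t = D d \<bullet> e - d \<bullet> D d / 2 + (Q t \<bullet> C u + u \<bullet> C u / 2)"
    unfolding energy_def yt DD[symmetric] QC[symmetric] by (simp add: e_def y'_def del: Q.simps)
  ultimately show ?thesis using main by (simp add: y'_def)
qed

text \<open>Of the final energy the \<open>D\<close> part is discarded as nonnegative; the
  \<open>C\<close> part is kept to pay for Young's inequality.\<close>

lemma summed_descent:
  "\<gamma> * (\<Sum>t=1..k. F (y t) - F ystar) + Q k \<bullet> C (Q k) / 2 \<le> energy 0"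
proof -
  have "\<gamma> * (\<Sum>t=1..k. F (y t) - F ystar) + energy k \<le> energy 0"
  proof (induction k)
    case (Suc k)
    then show ?case using energy_descent[of k] by (simp add: distrib_left)
  qed simp
  moreover have "0 \<le> (y k - ystar) \<bullet> D (y k - ystar)"
    using y_mem ystar_mem U by (intro D_psd subspace_diff)
  ultimately show ?thesis by (simp add: energy_def)
qed

text \<open>Jensen's inequality from the tangent at the average, whose linear terms sum to
  zero.\<close>

lemma F_average_le:
  assumes "k \<ge> 1"
  shows "real k * (F ((1 / real k) *\<^sub>R (\<Sum>t=1..k. y t)) - F ystar) \<le> (\<Sum>t=1..k. F (y t) - F ystar)"
proof -
  let ?a = "(1 / real k) *\<^sub>R (\<Sum>t=1..k. y t)"
  have "(\<Sum>t=1..k. F ?a + G ?a \<bullet> (y t - ?a)) \<le> (\<Sum>t=1..k. F (y t))"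
    by (rule sum_mono) (rule F_lower)
  moreover have "(\<Sum>t=1..k. G ?a \<bullet> (y t - ?a)) = 0"
    unfolding inner_sum_right[symmetric] sum_subtractf sum_constant_scaleR using assms by simp
  ultimately show ?thesis by (simp add: sum.distrib sum_subtractf algebra_simps)
qed

text \<open>\<open>p\<close> stands for the component of the average orthogonal to the kernel of
  \<open>C\<close>; \<open>c\<close> is fixed before \<open>k\<close> and \<open>p\<close>.\<close>

theorem ergodic_rate:
  obtains c where "\<And>k p. k \<ge> 1 \<Longrightarrow> p \<in> U \<Longrightarrow> (\<And>x. x \<in> U \<Longrightarrow> C x = 0 \<Longrightarrow> p \<bullet> x = 0) \<Longrightarrow>
      C ((1 / real k) *\<^sub>R (\<Sum>t=1..k. y t) - p) = 0 \<Longrightarrow>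
      norm p * norm (G ystar) \<le> c / real k \<and>
      \<bar>F ((1 / real k) *\<^sub>R (\<Sum>t=1..k. y t)) - F ystar\<bar> \<le> c / real k"
proof -
  obtain K where K: "\<And>v. v \<in> U \<Longrightarrow> (\<And>x. x \<in> U \<Longrightarrow> C x = 0 \<Longrightarrow> v \<bullet> x = 0)
      \<Longrightarrow> \<exists>r\<in>U. C r = v \<and> norm r \<le> K * norm v"
    by (rule selfadjoint_range_bounded_preimage[OF U C_linear C_mem C_sym]) blast
  obtain M where M: "0 < M" "\<And>x. norm (R x) \<le> M * norm x"
    using linear_bounded_pos[OF R_linear] by blast
  define g where "g = norm (G ystar)"
  \<comment> \<open>Initial energy plus half the bound \<open>qCq\<close>, over
    \<open>\<gamma>\<close>. Below, \<open>2 * g\<close> bounds \<open>norm v\<close> and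
    \<open>\<bar>K\<bar> * (2 * g)\<close> bounds \<open>norm r\<close>; the sign of
    \<open>K\<close> is unknown.\<close>
  define c where "c = (energy 0 + \<gamma>\<^sup>2 * ((M * (2 * g)) * (M * (\<bar>K\<bar> * (2 * g)))) / 2) / \<gamma>"
  have gc: "\<gamma> * c = energy 0 + \<gamma>\<^sup>2 * ((M * (2 * g)) * (M * (\<bar>K\<bar> * (2 * g)))) / 2"
    using gamma_pos by (simp add: c_def)
  show thesis
  proof (rule that)
    fix k :: nat and p
    let ?a = "(1 / real k) *\<^sub>R (\<Sum>t=1..k. y t)"
    assume k: "k \<ge> 1" and p: "p \<in> U" and orth: "\<And>x. x \<in> U \<Longrightarrow> C x = 0 \<Longrightarrow> p \<bullet> x = 0"
      and ap: "C (?a - p) = 0"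
    have apU: "?a - p \<in> U"
      using U p y_mem by (simp add: subspace_diff subspace_scale subspace_sum)
    \<comment> \<open>Length \<open>2 * g\<close> leaves one \<open>norm p * g\<close> over after
      the other offsets a negative function gap. For \<open>p = 0\<close> this is
      \<open>v = 0\<close>.\<close>
    define v where "v = (2 * g / norm p) *\<^sub>R p"
    have norm_v: "norm v \<le> 2 * g" by (cases "p = 0") (auto simp: v_def g_def)
    have "v \<in> U" "\<And>x. x \<in> U \<Longrightarrow> C x = 0 \<Longrightarrow> v \<bullet> x = 0"
      using p U orth by (auto simp: v_def subspace_scale)
    from K[OF this] obtain r where r: "r \<in> U" "C r = v" "norm r \<le> K * norm v" by blast
    \<comment> \<open>Chosen so that \<open>C q \<bullet> Q k\<close> becomes
      \<open>\<gamma> * (v \<bullet> R (Q k))\<close>, and \<open>R (Q k)\<close> is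
      \<open>k\<close> times the average.\<close>
    define q where "q = \<gamma> *\<^sub>R R r"
    have Cq: "C q = \<gamma> *\<^sub>R R v"
      using RC[OF r(1)] C_linear by (simp add: q_def linear_scale r(2))
    have norm_r: "norm r \<le> \<bar>K\<bar> * (2 * g)"
    proof -
      have "norm r \<le> \<bar>K\<bar> * norm v"
        using r(3) by (meson abs_ge_self mult_right_mono norm_ge_zero order_trans)
      also have "\<dots> \<le> \<bar>K\<bar> * (2 * g)" using norm_v by (intro mult_left_mono) auto
      finally show ?thesis .
    qed
    have qCq: "q \<bullet> C q \<le> \<gamma>\<^sup>2 * ((M * (2 * g)) * (M * (\<bar>K\<bar> * (2 * g))))"
    proof -
      have "R v \<bullet> R r \<le> norm (R v) * norm (R r)" by (rule norm_cauchy_schwarz)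
      also have "\<dots> \<le> (M * (2 * g)) * (M * (\<bar>K\<bar> * (2 * g)))"
      proof (rule mult_mono)
        show "norm (R v) \<le> M * (2 * g)"
          using M norm_v by (meson less_imp_le mult_left_mono order_trans)
        show "norm (R r) \<le> M * (\<bar>K\<bar> * (2 * g))"
          using M norm_r by (meson less_imp_le mult_left_mono order_trans)
      qed (use M in \<open>auto simp: g_def\<close>)
      finally have "\<gamma>\<^sup>2 * (R v \<bullet> R r) \<le> \<gamma>\<^sup>2 * ((M * (2 * g)) * (M * (\<bar>K\<bar> * (2 * g))))"
        by (intro mult_left_mono) auto
      then show ?thesis unfolding Cq by (simp add: q_def power2_eq_square inner_commute mult.assoc)
    qed
    have pa: "p \<bullet> ?a = (norm p)\<^sup>2"
      using orth[OF apU ap] by (simp only: inner_diff_right power2_norm_eq_inner)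
    have va: "v \<bullet> ?a = 2 * (norm p * g)"
    proof -
      have "v \<bullet> ?a = (2 * g / norm p) * (p \<bullet> ?a)" unfolding v_def by (rule inner_scaleR_left)
      then show ?thesis unfolding pa by (simp add: power2_eq_square)
    qed
    have "C q \<bullet> Q k = \<gamma> * (v \<bullet> R (Q k))" by (simp add: Cq R_sym)
    also have "R (Q k) = real k *\<^sub>R ?a" using k sum_y_eq[of k] by simp
    finally have CqQ: "C q \<bullet> Q k = \<gamma> * (real k * (2 * (norm p * g)))"
      unfolding inner_scaleR_right[of v "real k"] va .
    have young: "C q \<bullet> Q k \<le> Q k \<bullet> C (Q k) / 2 + q \<bullet> C q / 2"
      using C_psd[of "Q k - q"] C_linear C_sym[of q "Q k"]
      by (simp add: linear_diff inner_diff inner_commute)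
    have "\<gamma> * (real k * (F ?a - F ystar)) \<le> \<gamma> * (\<Sum>t=1..k. F (y t) - F ystar)"
      using F_average_le[OF k] gamma_pos by simp
    then have "\<gamma> * (real k * (F ?a - F ystar)) + C q \<bullet> Q k \<le> energy 0 + q \<bullet> C q / 2"
      using summed_descent[of k] young by linarith
    then have "\<gamma> * (real k * (F ?a - F ystar + 2 * (norm p * g))) \<le> \<gamma> * c"
      using qCq gc unfolding CqQ distrib_left by linarith
    then have "real k * (F ?a - F ystar + 2 * (norm p * g)) \<le> c"
      using gamma_pos by simp
    then have upper: "F ?a - F ystar + 2 * (norm p * g) \<le> c / real k"
      using k by (simp add: field_simps)
    \<comment> \<open>By optimality the gradient is orthogonal to the kernel vectors
      \<open>?a - p\<close> and \<open>ystar\<close>, so only the disagreement \<open>p\<close>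
      contributes.\<close>
    have "G ystar \<bullet> (?a - ystar) = G ystar \<bullet> (?a - p) + G ystar \<bullet> p - G ystar \<bullet> ystar"
      by (simp only: inner_diff_right)
    also have "\<dots> = G ystar \<bullet> p"
      using optimality[OF apU ap] optimality[OF ystar_mem C_ystar] by simp
    finally have "- (norm p * g) \<le> F ?a - F ystar"
      using F_lower[of ystar ?a] Cauchy_Schwarz_ineq2[of "G ystar" p]
      by (simp add: g_def mult.commute)
    moreover have "0 \<le> norm p * g" by (simp add: g_def)
    ultimately show "norm p * norm (G ystar) \<le> c / real k \<and> \<bar>F ?a - F ystar\<bar> \<le> c / real k"
      using upper unfolding g_def[symmetric] by linarith
  qed
qed

end

section \<open>Stacked variables\<close>

lemma stack_idx_Sigma: "stack_idx blk V = (\<lambda>(k, i). (i, k)) ` (SIGMA k:UNIV. V (blk k))"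
  by (auto simp: stack_idx_def image_iff)

lemma sum_stack_idx:
  fixes blk :: "'k::finite \<Rightarrow> 'p" and V :: "'p \<Rightarrow> 'i::finite set"
  shows "(\<Sum>j\<in>stack_idx blk V. h j) = (\<Sum>k\<in>UNIV. \<Sum>i\<in>V (blk k). h (i, k))"
proof -
  have "(\<Sum>j\<in>stack_idx blk V. h j) = (\<Sum>(k, i)\<in>(SIGMA k:UNIV. V (blk k)). h (i, k))"
    unfolding stack_idx_Sigma
    by (subst sum.reindex) (auto simp: inj_on_def case_prod_unfold intro!: sum.cong)
  then show ?thesis by (simp add: sum.Sigma)
qed

lemma local_copy_vec_on:
  "local_copy blk V (\<lambda>j. vec_on (stack_idx blk V) Y $ j) = local_copy blk V Y"
  by (auto simp: local_copy_def vec_on_nth stack_idx_def fun_eq_iff vec_eq_iff)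

lemma local_copy_diff:
  "local_copy blk V (\<lambda>j. (b - a) $ j) i = local_copy blk V (\<lambda>j. b $ j) i - local_copy blk V (\<lambda>j. a $ j) i"
  by (simp add: local_copy_def vec_eq_iff)

text \<open>The adjoint of taking local copies. It identifies \<open>stack_grad\<close> as the
  gradient of \<open>stack_f\<close>, so inequalities for the single \<open>f i\<close> can be
  summed.\<close>

lemma sum_inner_local_copy:
  fixes blk :: "'k::finite \<Rightarrow> 'p" and V :: "'p \<Rightarrow> 'i::finite set"
  shows "(\<Sum>i\<in>UNIV. g i \<bullet> local_copy blk V (\<lambda>j. x $ j) i)
       = vec_on (stack_idx blk V) (\<lambda>(i, k). g i $ k) \<bullet> x"
proof -
  have "(\<Sum>i\<in>UNIV. g i \<bullet> local_copy blk V (\<lambda>j. x $ j) i)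
      = (\<Sum>k\<in>UNIV. \<Sum>i\<in>UNIV. if i \<in> V (blk k) then g i $ k * x $ (i, k) else 0)"
    unfolding inner_vec_def
    by (subst sum.swap) (auto simp: local_copy_def intro!: sum.cong)
  also have "\<dots> = (\<Sum>k\<in>UNIV. \<Sum>i\<in>V (blk k). g i $ k * x $ (i, k))"
    by (simp add: sum.If_cases)
  finally show ?thesis by (simp add: vec_on_inner sum_stack_idx)
qed

text \<open>Each coordinate in the stack occurs in exactly one local copy and padding adds zero, so
  \<open>stack_f\<close> inherits the constant \<open>L\<close> of the summands unchanged.\<close>

lemma sum_local_copy_square_le:
  fixes blk :: "'k::finite \<Rightarrow> 'p" and V :: "'p \<Rightarrow> 'i::finite set"
  shows "(\<Sum>i\<in>UNIV. local_copy blk V (\<lambda>j. x $ j) i \<bullet> local_copy blk V (\<lambda>j. x $ j) i) \<le> x \<bullet> x"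
proof -
  have "(\<Sum>i\<in>UNIV. local_copy blk V (\<lambda>j. x $ j) i \<bullet> local_copy blk V (\<lambda>j. x $ j) i)
      = (\<Sum>j\<in>stack_idx blk V. x $ j * x $ j)"
    unfolding sum_inner_local_copy vec_on_inner
    by (intro sum.cong) (auto simp: local_copy_def stack_idx_def)
  also have "\<dots> \<le> x \<bullet> x"
    unfolding inner_vec_def inner_real_def by (rule sum_mono2) auto
  finally show ?thesis .
qed

lemma stack_f_descent:
  fixes f :: "'i::finite \<Rightarrow> real ^ 'k \<Rightarrow> real"
  assumes "\<And>i. L_smooth L (f i)" "0 \<le> L"
  shows "stack_f blk V f (\<lambda>j. b $ j) \<le> stack_f blk V f (\<lambda>j. a $ j)
    + vec_on (stack_idx blk V) (stack_grad blk V f (\<lambda>j. a $ j)) \<bullet> (b - a) + L / 2 * ((b - a) \<bullet> (b - a))"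
proof -
  let ?l = "\<lambda>x. local_copy blk V (\<lambda>j. x $ j)"
  have "stack_f blk V f (\<lambda>j. b $ j) \<le> (\<Sum>i\<in>UNIV. f i (?l a i) + grad (f i) (?l a i) \<bullet> ?l (b - a) i
      + L / 2 * (?l (b - a) i \<bullet> ?l (b - a) i))"
    unfolding stack_f_def local_copy_diff using assms(1) by (intro sum_mono L_smooth_descent)
  also have "\<dots> = stack_f blk V f (\<lambda>j. a $ j)
      + vec_on (stack_idx blk V) (stack_grad blk V f (\<lambda>j. a $ j)) \<bullet> (b - a)
      + L / 2 * (\<Sum>i\<in>UNIV. ?l (b - a) i \<bullet> ?l (b - a) i)"
    by (simp only: sum.distrib sum_inner_local_copy[where g = "\<lambda>i. grad (f i) (?l a i)"]
        sum_distrib_left stack_f_def stack_grad_def)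
  also have "\<dots> \<le> stack_f blk V f (\<lambda>j. a $ j)
      + vec_on (stack_idx blk V) (stack_grad blk V f (\<lambda>j. a $ j)) \<bullet> (b - a)
      + L / 2 * ((b - a) \<bullet> (b - a))"
    using assms(2) by (intro add_left_mono mult_left_mono sum_local_copy_square_le) simp
  finally show ?thesis .
qed

lemma stack_f_above_tangent:
  fixes f :: "'i::finite \<Rightarrow> real ^ 'k \<Rightarrow> real"
  assumes "\<And>i. convex_on UNIV (f i)" "\<And>i x. f i differentiable (at x)"
  shows "stack_f blk V f (\<lambda>j. a $ j)
    + vec_on (stack_idx blk V) (stack_grad blk V f (\<lambda>j. a $ j)) \<bullet> (b - a) \<le> stack_f blk V f (\<lambda>j. b $ j)"
proof -
  let ?l = "\<lambda>x. local_copy blk V (\<lambda>j. x $ j)"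
  have "stack_f blk V f (\<lambda>j. a $ j)
      + vec_on (stack_idx blk V) (stack_grad blk V f (\<lambda>j. a $ j)) \<bullet> (b - a)
      = (\<Sum>i\<in>UNIV. f i (?l a i) + grad (f i) (?l a i) \<bullet> ?l (b - a) i)"
    by (simp only: sum.distrib sum_inner_local_copy[where g = "\<lambda>i. grad (f i) (?l a i)"]
        stack_f_def stack_grad_def)
  also have "\<dots> \<le> stack_f blk V f (\<lambda>j. b $ j)"
    unfolding stack_f_def local_copy_diff using assms by (intro sum_mono convex_above_tangent_grad)
  finally show ?thesis .
qed

section \<open>Deviation from consensus\<close>

text \<open>For each coordinate the deviations from the mean sum to zero, while a consensus vector
  is constant over the agents.\<close>

lemma Pi_perp_orthogonal_consensus:
  fixes blk :: "'k::finite \<Rightarrow> 'p" and V :: "'p \<Rightarrow> 'i::finite set"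
  assumes "(\<lambda>j. x $ j) \<in> consensus blk V"
  shows "vec_on (stack_idx blk V) (Pi_perp blk V W) \<bullet> x = 0"
proof -
  obtain v where v: "\<And>i k. i \<in> V (blk k) \<Longrightarrow> x $ (i, k) = v k"
    using assms by (auto simp: consensus_def stack_idx_def)
  have "(\<Sum>i\<in>V (blk k). Pi_perp blk V W (i, k) * x $ (i, k)) = 0" for k
  proof -
    have "(\<Sum>i\<in>V (blk k). Pi_perp blk V W (i, k) * x $ (i, k))
        = (\<Sum>i\<in>V (blk k). Pi_perp blk V W (i, k)) * v k"
      by (simp add: v sum_distrib_right)
    also have "(\<Sum>i\<in>V (blk k). Pi_perp blk V W (i, k)) = 0"
      by (cases "V (blk k) = {}") (auto simp: Pi_perp_def sum_subtractf)
    finally show ?thesis by simp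
  qed
  then show ?thesis by (simp add: vec_on_inner sum_stack_idx)
qed

lemma diff_Pi_perp_consensus: "(\<lambda>j. W j - Pi_perp blk V W j) \<in> consensus blk V"
  unfolding consensus_def Pi_perp_def
  by (auto intro!: exI[of _ "\<lambda>k. (\<Sum>i'\<in>V (blk k). W (i', k)) / real (card (V (blk k)))"])

section \<open>Reduction of the stacked iteration to the abstract one\<close>

theorem theorem3:
  fixes f :: "'i::finite \<Rightarrow> real ^ 'k \<Rightarrow> real"
    and blk :: "'k \<Rightarrow> 'p"
    and N :: "'i \<Rightarrow> 'p set"
    and V :: "'p \<Rightarrow> 'i set"
    and Ap Bp Cp Dp :: "'p \<Rightarrow> 'i \<Rightarrow> 'i \<Rightarrow> real"
    and L \<gamma> :: real
    and ystar :: "real ^ 'k"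
    and Y Z :: "nat \<Rightarrow> ('i \<times> 'k) \<Rightarrow> real"
  defines "S \<equiv> stack_idx blk V"
    and "A \<equiv> big_mat blk Ap" and "B \<equiv> big_mat blk Bp"
    and "C \<equiv> big_mat blk Cp" and "D \<equiv> big_mat blk Dp"
    and "Ystar \<equiv> (\<lambda>(i,k). ystar $ k)"
  assumes V_cover: "\<And>p. {i. p \<in> N i} \<subseteq> V p"
    and f_local: "\<And>i y y'. (\<forall>k. blk k \<in> N i \<longrightarrow> y $ k = y' $ k) \<Longrightarrow> f i y = f i y'"
    and f_convex: "\<And>i. convex_on UNIV (f i)"
    and L_pos: "L > 0"
    and f_smooth: "\<And>i. L_smooth L (f i)"
    and ystar_opt: "\<And>y. (\<Sum>i\<in>UNIV. f i ystar) \<le> (\<Sum>i\<in>UNIV. f i y)"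
    and c1: "mat_eq S A (mat_mult S B D)" "mat_psd S B" "mat_pd S D"
    and c2: "\<And>W. W \<in> consensus blk V \<Longrightarrow> \<forall>x\<in>S. mat_vec S D W x = W x"
            "\<And>W. W \<in> consensus blk V \<Longrightarrow> \<forall>x\<in>S. mat_vec S B W x = W x"
    and c3: "mat_psd S C" "\<And>W. (\<forall>x\<in>S. mat_vec S C W x = 0) \<longleftrightarrow> W \<in> consensus blk V"
    and c4: "mat_eq S (mat_mult S B C) (mat_mult S C B)"
    and c5: "mat_psd S (\<lambda>x y. mat_id x y - C x y / 2
               - mat_mult S (mat_mult S (mat_sqrt S B) D) (mat_sqrt S B) x y)"
    and gamma: "0 < \<gamma>" "\<gamma> < lambda_min S D / L"
    and Z0: "\<forall>x\<in>S. Z 0 x = 0"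
    and Y_step: "\<And>t. \<forall>x\<in>S. Y (Suc t) x = mat_vec S A (Y t) x
                   - \<gamma> * mat_vec S B (stack_grad blk V f (Y t)) x - Z t x"
    and Z_step: "\<And>t. \<forall>x\<in>S. Z (Suc t) x = Z t x + mat_vec S C (Y (Suc t)) x"
  shows "\<exists>c. \<forall>k::nat. k \<ge> 1 \<longrightarrow>
           merit blk V f Ystar (\<lambda>x. (\<Sum>t=1..k. Y t x) / real k) \<le> c / real k"
proof -
  let ?U = "supp_space S"
  define R where "R = mat_op S (mat_sqrt S B)"
  define C' where "C' = mat_op S C"
  define D' where "D' = mat_op S D"
  define F where "F x = stack_f blk V f (\<lambda>j. x $ j)" for x
  define G where "G x = vec_on S (stack_grad blk V f (\<lambda>j. x $ j))" for x
  define ys where "ys = vec_on S Ystar"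
  have sqrtB: "mat_psd S (mat_sqrt S B)"
    and sqrtB2: "mat_eq S (mat_mult S (mat_sqrt S B) (mat_sqrt S B)) B"
    using mat_sqrt_properties[OF c1(2)] by auto
  have symm: "mat_sym S (mat_sqrt S B)" "mat_sym S C" "mat_sym S D"
    using sqrtB c3(1) c1(3) by (auto simp: mat_psd_def mat_pd_def)
  have RR: "R (R x) = mat_op S B x" if "x \<in> ?U" for x
    using sqrtB2 that by (simp add: R_def mat_eq_iff_mat_op mat_op_mult)
  have lin: "linear R" "linear C'" "linear D'"
    by (simp_all add: R_def C'_def D'_def linear_mat_op)
  have mem: "R x \<in> ?U" "C' x \<in> ?U" "D' x \<in> ?U" for x
    by (simp_all add: R_def C'_def D'_def)
  have R_sym: "R x \<bullet> y = x \<bullet> R y" for x y by (simp add: R_def mat_op_selfadjoint symm)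
  have R_psd: "0 \<le> x \<bullet> R x" for x by (simp add: R_def mat_op_psd sqrtB)
  have null_C: "C' x = 0 \<longleftrightarrow> (\<lambda>j. x $ j) \<in> consensus blk V" for x
    unfolding c3(2)[symmetric] C'_def mat_op_def vec_on_def vec_eq_iff by auto
  have Ystar_cons: "Ystar \<in> consensus blk V"
    by (auto simp: Ystar_def consensus_def)
  have F_vec: "F (vec_on S W) = stack_f blk V f W" for W
    by (simp add: F_def stack_f_def S_def local_copy_vec_on)
  have G_vec: "G (vec_on S W) = vec_on S (stack_grad blk V f W)" for W
    by (simp add: G_def stack_grad_def S_def local_copy_vec_on)
  have vec_add: "vec_on S v + vec_on S w = vec_on S (\<lambda>x. v x + w x)" for v w
    by (simp add: vec_eq_iff vec_on_nth)
  have RC: "R (C' x) = C' (R x)" if "x \<in> ?U" for x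
  proof (rule psd_sqrt_commutes[OF subspace_supp_space, where x = x])
    show "R (R (C' x)) = C' (R (R x))" if "x \<in> ?U" for x
      using that c4 by (simp add: RR mem) (simp add: C'_def mat_eq_iff_mat_op mat_op_mult)
  qed (use that lin mem R_sym R_psd in auto)
  have gap: "(x \<bullet> C' x) / 2 + R x \<bullet> D' (R x) \<le> x \<bullet> x" if x: "x \<in> ?U" for x
  proof -
    let ?M = "mat_mult S (mat_mult S (mat_sqrt S B) D) (mat_sqrt S B)"
    have "mat_op S (\<lambda>x y. mat_id x y - C x y / 2 - ?M x y) x = x - (1/2) *\<^sub>R C' x - mat_op S ?M x"
    proof -
      have "(\<Sum>k\<in>S. mat_id j k * x $ k) = x $ j" if "j \<in> S" for j
        using that by (simp add: mat_id_def if_distrib[of "\<lambda>t. t * _"] cong: if_cong)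
      then show ?thesis
        using x by (auto simp: vec_eq_iff mat_op_nth C'_def supp_space_def left_diff_distrib
            sum_subtractf sum_divide_distrib)
    qed
    also have "mat_op S ?M x = R (D' (R x))"
      by (simp add: mat_op_mult R_def D'_def)
    finally have "0 \<le> x \<bullet> (x - (1/2) *\<^sub>R C' x - R (D' (R x)))"
      using mat_op_psd[OF c5, of x] by simp
    then show ?thesis by (simp add: inner_diff_right R_sym)
  qed
  \<comment> \<open>Condition (ii) speaks of \<open>B\<close>; its root fixes \<open>ys\<close> too,
    since 1 is the nonnegative root of 1.\<close>
  have R_ystar: "R ys = ys"
  proof -
    have "mat_op S B ys = ys"
      unfolding ys_def mat_op_vec_on using c2(2)[OF Ystar_cons] by (intro vec_on_cong) auto
    then have "R (R ys) = 1\<^sup>2 *\<^sub>R ys" by (simp add: RR ys_def)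
    then have "R ys = 1 *\<^sub>R ys"
      by (intro psd_eigenvector_of_square[OF lin(1) mem(1) subspace_supp_space])
         (auto simp: R_sym R_psd ys_def)
    then show ?thesis by simp
  qed
  have D_ystar: "D' ys = ys"
    unfolding D'_def ys_def mat_op_vec_on using c2(1)[OF Ystar_cons] by (intro vec_on_cong) auto
  have C_ystar: "C' ys = 0"
  proof -
    have "\<forall>x\<in>S. mat_vec S C Ystar x = 0" using Ystar_cons by (simp add: c3(2))
    then show ?thesis
      unfolding C'_def ys_def mat_op_vec_on by (simp add: vec_eq_iff vec_on_nth)
  qed
  have F_upper: "F b \<le> F a + G a \<bullet> (b - a) + L / 2 * ((b - a) \<bullet> (b - a))" for a b
    unfolding F_def G_def S_def using f_smooth L_pos by (intro stack_f_descent) auto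
  have F_lower: "F a + G a \<bullet> (b - a) \<le> F b" for a b
    unfolding F_def G_def S_def using f_smooth f_convex
    by (intro stack_f_above_tangent) (auto simp: L_smooth_def)
  have optimality: "G ys \<bullet> x = 0" if Cx: "C' x = 0" for x
  proof -
    obtain v where v: "\<And>i k. i \<in> V (blk k) \<Longrightarrow> x $ (i, k) = v k"
      using Cx unfolding null_C by (auto simp: consensus_def stack_idx_def)
    \<comment> \<open>A kernel direction is a consensus direction, so along it \<open>F\<close> is
      the original objective. Zero-padded coordinates of a local copy are invisible to
      \<open>f i\<close>, by \<open>V_cover\<close> and \<open>f_local\<close>.\<close>
    have shift: "F (ys + t *\<^sub>R x) = (\<Sum>i\<in>UNIV. f i (ystar + t *\<^sub>R (\<chi> k. v k)))" for t
      unfolding F_def stack_f_def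
    proof (intro sum.cong refl f_local allI impI)
      fix i k assume "blk k \<in> N i"
      then have "i \<in> V (blk k)" using V_cover by auto
      then show "local_copy blk V (\<lambda>j. (ys + t *\<^sub>R x) $ j) i $ k = (ystar + t *\<^sub>R (\<chi> k. v k)) $ k"
        by (simp add: local_copy_def ys_def vec_on_nth S_def stack_idx_def Ystar_def v)
    qed
    \<comment> \<open>Minimality of \<open>ystar\<close> against the smoothness upper bound.\<close>
    have "0 \<le> t * (G ys \<bullet> x) + t\<^sup>2 * (L / 2 * (x \<bullet> x))" for t
    proof -
      have "F ys \<le> F (ys + t *\<^sub>R x)"
        using shift[of t] shift[of 0] ystar_opt by simp
      then show ?thesis
        using F_upper[of "ys + t *\<^sub>R x" ys] by (simp add: power2_eq_square mult_ac)
    qed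
    then show ?thesis by (rule quadratic_nonneg_imp_linear_zero)
  qed
  have y_Suc: "vec_on S (Y (Suc t))
      = R (R (D' (vec_on S (Y t)) - \<gamma> *\<^sub>R G (vec_on S (Y t)))) - vec_on S (Z t)" for t
  proof -
    have "vec_on S (Y (Suc t)) = mat_op S A (vec_on S (Y t))
        - \<gamma> *\<^sub>R mat_op S B (G (vec_on S (Y t))) - vec_on S (Z t)"
      using Y_step[of t] by (simp add: G_vec mat_op_vec_on vec_eq_iff vec_on_nth)
    moreover have "mat_op S A (vec_on S (Y t)) = R (R (D' (vec_on S (Y t))))"
      using c1(1) by (simp add: RR mem mat_eq_iff_mat_op mat_op_mult) (simp add: D'_def)
    moreover have "mat_op S B (G (vec_on S (Y t))) = R (R (G (vec_on S (Y t))))"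
      by (simp add: RR G_vec)
    ultimately show ?thesis using lin by (simp add: linear_diff linear_scale)
  qed
  have z_Suc: "vec_on S (Z (Suc t)) = vec_on S (Z t) + C' (vec_on S (Y (Suc t)))" for t
    unfolding C'_def mat_op_vec_on vec_add using Z_step[of t] by (intro vec_on_cong) auto
  interpret abc_iteration ?U R C' D' F G L \<gamma> "lambda_min S D" ys
    "\<lambda>t. vec_on S (Y t)" "\<lambda>t. vec_on S (Z t)"
  proof (rule abc_iteration.intro)
    show "C' x \<bullet> y = x \<bullet> C' y" "D' x \<bullet> y = x \<bullet> D' y" for x y
      by (simp_all add: C'_def D'_def mat_op_selfadjoint symm)
    show "0 \<le> x \<bullet> C' x" for x by (simp add: C'_def mat_op_psd c3)
    show "lambda_min S D * (x \<bullet> x) \<le> x \<bullet> D' x" if "x \<in> ?U" for x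
      unfolding D'_def using symm that by (intro lambda_min_le_quadratic_form) auto
    show "\<gamma> * L \<le> lambda_min S D" using gamma L_pos by (simp add: field_simps)
    show "vec_on S (Z 0) = 0" using Z0 by (simp add: vec_eq_iff vec_on_nth)
    show "ys \<in> ?U" by (simp add: ys_def)
  qed (use subspace_supp_space lin mem R_sym RC gap C_ystar R_ystar D_ystar F_upper F_lower
        optimality L_pos gamma y_Suc z_Suc in auto)
  obtain c where c: "\<And>k p. k \<ge> 1 \<Longrightarrow> p \<in> ?U \<Longrightarrow> (\<And>x. x \<in> ?U \<Longrightarrow> C' x = 0 \<Longrightarrow> p \<bullet> x = 0) \<Longrightarrow>
      C' ((1 / real k) *\<^sub>R (\<Sum>t=1..k. vec_on S (Y t)) - p) = 0 \<Longrightarrow>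
      norm p * norm (G ys) \<le> c / real k \<and>
      \<bar>F ((1 / real k) *\<^sub>R (\<Sum>t=1..k. vec_on S (Y t))) - F ys\<bar> \<le> c / real k"
    using ergodic_rate by blast
  show ?thesis
  proof (intro exI[of _ c] allI impI)
    fix k :: nat assume k: "k \<ge> 1"
    let ?W = "\<lambda>x. (\<Sum>t=1..k. Y t x) / real k"
    \<comment> \<open>This is the \<open>p\<close> of \<open>ergodic_rate\<close>: the rest of the
      average is a consensus vector, hence in the kernel of \<open>C\<close> by (iii).\<close>
    let ?p = "vec_on S (Pi_perp blk V ?W)"
    have avg: "(1 / real k) *\<^sub>R (\<Sum>t=1..k. vec_on S (Y t)) = vec_on S ?W"
      by (simp add: vec_eq_iff vec_on_nth)
    have diff: "vec_on S ?W - ?p = vec_on S (\<lambda>j. ?W j - Pi_perp blk V ?W j)"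
      by (simp add: vec_eq_iff vec_on_nth)
    have "C' (vec_on S ?W - ?p) = 0"
    proof -
      have "\<forall>x\<in>S. mat_vec S C (\<lambda>j. ?W j - Pi_perp blk V ?W j) x = 0"
        unfolding c3(2) by (rule diff_Pi_perp_consensus)
      then show ?thesis
        unfolding diff C'_def mat_op_vec_on by (simp add: vec_eq_iff vec_on_nth)
    qed
    moreover have "?p \<bullet> x = 0" if "C' x = 0" for x
      using that Pi_perp_orthogonal_consensus[of x blk V ?W] by (simp add: null_C S_def)
    ultimately have "norm ?p * norm (G ys) \<le> c / real k \<and> \<bar>F (vec_on S ?W) - F ys\<bar> \<le> c / real k"
      using c[of k ?p] k unfolding avg by simp
    then show "merit blk V f Ystar ?W \<le> c / real k"
      unfolding merit_def ys_def F_vec G_vec norm_vec_on unfolding S_def by simp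
  qed
qed

end
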